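(* Assume conditions (i) and (ii) of the context. There exists a polynomial $h:\mathbb R^5\to\mathbb R$ such that for every $d\in\mathbb N$, every architecture $a$ with input dimension $d$, all $R,D\in(0,\infty)$, all $\varepsilon,\varrho\in(0,1)$ and every $m\in\mathbb N$ with $$m\ge h\big(\varepsilon^{-1},P(a),\log R,\varrho^{-1},D\big),$$ it holds with $\mathcal H=\mathcal N_{a,R,D}$ that $$\mathbb P\big(\mathcal E_d(f_{d,m,\mathcal H})-\mathcal E_d(f_{d,\mathcal H})\le\varepsilon\big)\ge1-\varrho.$$
   Context: Fix $T\in(0,\infty)$ and reals $u<v$. For each $d\in\mathbb N$: $\mu_d:\mathbb R^d\to\mathbb R^d$, $\sigma_d:\mathbb R^d\to\mathbb R^{d\times d}$ Lipschitz, $\varphi_d:\mathbb R^d\to\mathbb R$ measurable; on a probability space $(\Omega,\mathcal F,\mathbb P)$ with normal filtration $(\mathcal F_t)_{t\in[0,T]}$, $B$ a standard $d$-dimensional Brownian motion, $X_d:\Omega\to[u,v]^d$ uniform and $\mathcal F_0$-measurable, $(S_t)$ the continuous adapted solution of $S_t=X_d+\int_0^t\mu_d(S_s)ds+\int_0^t\sigma_d(S_s)dB_s$, $Y_d=S_T=(Y_{d,1},\dots,Y_{d,d})$. Risk $\mathcal E_d(f)=\mathbb E[(f(X_d)-\varphi_d(Y_d))^2]$; $(\mathbf x_i,\mathbf y_i)_{i\ge1}$ i.i.d. copies of $(X_d,Y_d)$; empirical risk $\mathcal E_{d,m}(f)=\frac1m\sum_{i=1}^m(f(\mathbf x_i)-\varphi_d(\mathbf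 y_i))^2$. For compact $\mathcal H\subseteq C([u,v]^d)$ (sup norm), $f_{d,\mathcal H}$ minimizes $\mathcal E_d$ over $\mathcal H$ and $f_{d,m,\mathcal H}:\Omega\to\mathcal H$ is a measurable minimizer of $\mathcal E_{d,m}$ over $\mathcal H$. Conditions: (i) there is $c_1\in(0,\infty)$ with $\mathbb P(|Y_{d,i}|\ge t)\le2\exp\{-c_1(\log t)^2\}$ for all $d$, $t\in[1,\infty)$, $i\le d$; (ii) there are $c_2\in(0,\infty)$, $\lambda\in[2,\infty)$ with $|\varphi_d(y)|\le c_2(1+\|y\|_2^\lambda)$ for all $d$, $y\in\mathbb R^d$. ReLU networks: architecture $a=(N_0,\dots,N_L)$ with $N_0=d$, $N_L=1$; parameters $\theta=((A_l,b_l))_{l=1}^L$, $A_l\in\mathbb R^{N_l\times N_{l-1}}$, $b_l\in\mathbb R^{N_l}$; $\Phi_\theta=W_L\circ\rho\circ\cdots\circ\rho\circ W_1$, $W_l(x)=A_lx+b_l$, $\rho$ componentwise ReLU; $\|\theta\|_\infty$ maximal absolute entry; $P(a)=\sum_{l=1}^LN_l(N_{l-1}+1)$; $\mathcal N_{a,R}=\{\Phi_\theta|_{[u,v]^d}:\|\theta\|_\infty\le R\}$; $\mathrm{Clip}_D(x)=\min\{|x|,D\}\operatorname{sgn}(x)$; $\mathcal N_{a,R,D}=\{\mathrm{Clip}_D\circ\Phi:\Phi\in\mathcal N_{a,R}\}$ (a compact subset of $C([u,v]^d)$). *)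

theory Defs
  imports "HOL-Probability.Probability"
begin

text \<open>Points of R^d are represented as extensional functions nat => real
  (coordinates 0..d-1), i.e. elements of {..<d} ->E UNIV.\<close>

definition cube :: "real \<Rightarrow> real \<Rightarrow> nat \<Rightarrow> (nat \<Rightarrow> real) set" where
  "cube u v d = PiE {..<d} (\<lambda>_. {u..v})"

definition l2norm :: "nat \<Rightarrow> (nat \<Rightarrow> real) \<Rightarrow> real" where
  "l2norm d y = sqrt (\<Sum>i<d. (y i)\<^sup>2)"

definition clip :: "real \<Rightarrow> real \<Rightarrow> real" where
  "clip D x = min \<bar>x\<bar> D * sgn x"

text \<open>A layer is a pair (A, b): weight matrix A (entry A j k, row j < N_l,
  column k < N_(l-1)) and bias vector b.\<close>
type_synonym layer = "(nat \<Rightarrow> nat \<Rightarrow> real) \<times> (nat \<Rightarrow> real)"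

definition affine :: "nat \<Rightarrow> layer \<Rightarrow> (nat \<Rightarrow> real) \<Rightarrow> (nat \<Rightarrow> real)" where
  "affine n l x = (\<lambda>j. (\<Sum>k<n. fst l j k * x k) + snd l j)"

definition relu_vec :: "(nat \<Rightarrow> real) \<Rightarrow> (nat \<Rightarrow> real)" where
  "relu_vec x = (\<lambda>j. max 0 (x j))"

fun net_eval :: "nat list \<Rightarrow> layer list \<Rightarrow> (nat \<Rightarrow> real) \<Rightarrow> (nat \<Rightarrow> real)" where
  "net_eval [n0, n1] [l] x = affine n0 l x"
| "net_eval (n0 # n1 # n2 # ns) (l # ls) x = net_eval (n1 # n2 # ns) ls (relu_vec (affine n0 l x))"
| "net_eval _ _ x = (\<lambda>_. 0)"

definition architecture :: "nat \<Rightarrow> nat list \<Rightarrow> bool" where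
  "architecture d a \<longleftrightarrow> length a \<ge> 2 \<and> hd a = d \<and> last a = 1 \<and> (\<forall>n\<in>set a. n \<ge> 1)"

definition num_params :: "nat list \<Rightarrow> nat" where
  "num_params a = (\<Sum>l\<in>{1..<length a}. a ! l * (a ! (l - 1) + 1))"

definition param_ok :: "nat list \<Rightarrow> real \<Rightarrow> layer list \<Rightarrow> bool" where
  "param_ok a R \<theta> \<longleftrightarrow> length \<theta> = length a - 1 \<and>
     (\<forall>l<length \<theta>. \<forall>j<a ! (l + 1).
        \<bar>snd (\<theta> ! l) j\<bar> \<le> R \<and> (\<forall>k<a ! l. \<bar>fst (\<theta> ! l) j k\<bar> \<le> R))"

definition nn_class :: "real \<Rightarrow> real \<Rightarrow> nat list \<Rightarrow> real \<Rightarrow> real \<Rightarrow> ((nat \<Rightarrow> real) \<Rightarrow> real) set" where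
  "nn_class u v a R D =
     {restrict (\<lambda>x. clip D (net_eval a \<theta> x 0)) (cube u v (hd a)) | \<theta>. param_ok a R \<theta>}"

definition sup_dist :: "real \<Rightarrow> real \<Rightarrow> nat \<Rightarrow> ((nat \<Rightarrow> real) \<Rightarrow> real) \<Rightarrow> ((nat \<Rightarrow> real) \<Rightarrow> real) \<Rightarrow> real" where
  "sup_dist u v d f g = (SUP x\<in>cube u v d. \<bar>f x - g x\<bar>)"

definition sup_borel :: "real \<Rightarrow> real \<Rightarrow> nat \<Rightarrow> ((nat \<Rightarrow> real) \<Rightarrow> real) set \<Rightarrow> ((nat \<Rightarrow> real) \<Rightarrow> real) measure" where
  "sup_borel u v d H = sigma H
     {U. U \<subseteq> H \<and> (\<forall>f\<in>U. \<exists>r>0. {g\<in>H. sup_dist u v d f g < r} \<subseteq> U)}"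

definition poly5 :: "(real \<Rightarrow> real \<Rightarrow> real \<Rightarrow> real \<Rightarrow> real \<Rightarrow> real) \<Rightarrow> bool" where
  "poly5 h \<longleftrightarrow> (\<exists>(N::nat) (c :: nat \<Rightarrow> nat \<Rightarrow> nat \<Rightarrow> nat \<Rightarrow> nat \<Rightarrow> real).
     \<forall>x1 x2 x3 x4 x5. h x1 x2 x3 x4 x5 =
       (\<Sum>i1\<le>N. \<Sum>i2\<le>N. \<Sum>i3\<le>N. \<Sum>i4\<le>N. \<Sum>i5\<le>N.
          c i1 i2 i3 i4 i5 * x1 ^ i1 * x2 ^ i2 * x3 ^ i3 * x4 ^ i4 * x5 ^ i5))"

definition Rd :: "nat \<Rightarrow> (nat \<Rightarrow> real) measure" where
  "Rd d = PiM {..<d} (\<lambda>_. lborel)"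

definition risk :: "'a measure \<Rightarrow> ('a \<Rightarrow> nat \<Rightarrow> real) \<Rightarrow> ('a \<Rightarrow> nat \<Rightarrow> real) \<Rightarrow> ((nat \<Rightarrow> real) \<Rightarrow> real)
     \<Rightarrow> ((nat \<Rightarrow> real) \<Rightarrow> real) \<Rightarrow> real" where
  "risk M X Y \<phi> f = (\<integral>\<omega>. (f (X \<omega>) - \<phi> (Y \<omega>))\<^sup>2 \<partial>M)"

definition emp_risk :: "nat \<Rightarrow> (nat \<Rightarrow> 'a \<Rightarrow> nat \<Rightarrow> real) \<Rightarrow> (nat \<Rightarrow> 'a \<Rightarrow> nat \<Rightarrow> real)
     \<Rightarrow> ((nat \<Rightarrow> real) \<Rightarrow> real) \<Rightarrow> ((nat \<Rightarrow> real) \<Rightarrow> real) \<Rightarrow> 'a \<Rightarrow> real" where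
  "emp_risk m xs ys \<phi> f \<omega> = (\<Sum>i<m. (f (xs i \<omega>) - \<phi> (ys i \<omega>))\<^sup>2) / m"

end

theory Submission
  imports Defs
begin

text \<open>
  Since \<open>(f(X) - \<phi>(Y))\<^sup>2 = f(X)\<^sup>2 - 2 f(X) \<phi>(Y) + \<phi>(Y)\<^sup>2\<close>, the last term cancels in excess risks, and
  only the deviations of \<open>f(X)\<^sup>2 - 2 f(X) \<phi>(Y)\<close> from their means have to be controlled uniformly in \<open>f\<close>.
  The tail condition bounds the second moment of \<open>\<phi>(Y)\<close> polynomially in the dimension. Truncating \<open>\<phi>\<close>
  at a level polynomial in \<open>1/\<epsilon>\<close>, \<open>1/\<rho>\<close>, \<open>P(a)\<close> and \<open>D\<close>, the tail part is handled by Markov's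
  inequality alone, because a polynomial dependence on \<open>1/\<rho>\<close> is allowed. The truncated part is bounded, so
  Hoeffding's inequality and a union bound over a finite net apply. Rounding the parameters to a
  grid gives such a net, and the logarithm of its cardinality is polynomial because the
  realization map is Lipschitz in the parameters with constant exponential in \<open>P(a)\<close> and \<open>log R\<close>.
\<close>

section \<open>Polynomials in five variables\<close>

text \<open>Closure under sums and products is easier to obtain for a sum over an arbitrary finite
  index set \<open>J\<close> than for five nested sums. Monomials sharing an exponent tuple are
  collected in the coefficient \<open>c'\<close>.\<close>

lemma poly5I:
  assumes J: "finite J"
    and h: "\<And>x1 x2 x3 x4 x5. h x1 x2 x3 x4 x5 =
      (\<Sum>j\<in>J. c j * x1 ^ e1 j * x2 ^ e2 j * x3 ^ e3 j * x4 ^ e4 j * x5 ^ e5 j)"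
  shows "poly5 h"
proof -
  \<comment> \<open>Any common bound of all exponents would do; their total is one that also makes
    sense for empty \<open>J\<close>.\<close>
  define N where "N = (\<Sum>j\<in>J. e1 j + e2 j + e3 j + e4 j + e5 j)"
  have le: "e1 j \<le> N \<and> e2 j \<le> N \<and> e3 j \<le> N \<and> e4 j \<le> N \<and> e5 j \<le> N" if "j \<in> J" for j
    using member_le_sum[OF that, of "\<lambda>j. e1 j + e2 j + e3 j + e4 j + e5 j"] J
    by (auto simp: N_def)
  define c' where "c' i1 i2 i3 i4 i5 =
     (\<Sum>j\<in>J. if e1 j = i1 \<and> e2 j = i2 \<and> e3 j = i3 \<and> e4 j = i4 \<and> e5 j = i5 then c j else 0)"
    for i1 i2 i3 i4 i5
  have "h x1 x2 x3 x4 x5 =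
       (\<Sum>i1\<le>N. \<Sum>i2\<le>N. \<Sum>i3\<le>N. \<Sum>i4\<le>N. \<Sum>i5\<le>N.
          c' i1 i2 i3 i4 i5 * x1 ^ i1 * x2 ^ i2 * x3 ^ i3 * x4 ^ i4 * x5 ^ i5)" for x1 x2 x3 x4 x5
  proof -
    let ?m = "\<lambda>(i1, i2, i3, i4, i5). x1 ^ i1 * x2 ^ i2 * x3 ^ i3 * x4 ^ i4 * x5 ^ i5"
    let ?e = "\<lambda>j. (e1 j, e2 j, e3 j, e4 j, e5 j)"
    let ?B = "{..N} \<times> {..N} \<times> {..N} \<times> {..N} \<times> {..N}"
    have "(\<Sum>i1\<le>N. \<Sum>i2\<le>N. \<Sum>i3\<le>N. \<Sum>i4\<le>N. \<Sum>i5\<le>N.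
          c' i1 i2 i3 i4 i5 * x1 ^ i1 * x2 ^ i2 * x3 ^ i3 * x4 ^ i4 * x5 ^ i5)
        = (\<Sum>i\<in>?B. (\<Sum>j\<in>J. if ?e j = i then c j else 0) * ?m i)"
      by (simp add: sum.cartesian_product c'_def case_prod_unfold mult.assoc prod_eq_iff)
    also have "\<dots> = (\<Sum>j\<in>J. \<Sum>i\<in>?B. (if ?e j = i then c j * ?m i else 0))"
      by (subst sum.swap) (auto simp: sum_distrib_right intro!: sum.cong)
    also have "\<dots> = (\<Sum>j\<in>J. c j * ?m (?e j))"
      using le by (intro sum.cong refl) (subst sum.delta', auto)
    also have "\<dots> = h x1 x2 x3 x4 x5"
      by (simp add: h mult.assoc)
    finally show ?thesis ..
  qed
  then show ?thesis unfolding poly5_def by blast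
qed

text \<open>The box of exponent tuples serves as index set, with the projections as exponents; this
  brings \<open>poly5\<close> back to the form required by \<open>poly5I\<close>.\<close>

lemma poly5E:
  assumes "poly5 h"
  obtains J :: "(nat \<times> nat \<times> nat \<times> nat \<times> nat) set" and c e1 e2 e3 e4 e5 where "finite J"
    "\<And>x1 x2 x3 x4 x5. h x1 x2 x3 x4 x5 =
      (\<Sum>j\<in>J. c j * x1 ^ e1 j * x2 ^ e2 j * x3 ^ e3 j * x4 ^ e4 j * x5 ^ e5 j)"
proof -
  obtain N c where h: "\<And>x1 x2 x3 x4 x5. h x1 x2 x3 x4 x5 =
       (\<Sum>i1\<le>N. \<Sum>i2\<le>N. \<Sum>i3\<le>N. \<Sum>i4\<le>N. \<Sum>i5\<le>(N::nat).
          c i1 i2 i3 i4 i5 * x1 ^ i1 * x2 ^ i2 * x3 ^ i3 * x4 ^ i4 * x5 ^ i5)"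
    using assms unfolding poly5_def by blast
  show thesis
    by (rule that[of "{..N} \<times> {..N} \<times> {..N} \<times> {..N} \<times> {..N}" "\<lambda>(i1, i2, i3, i4, i5). c i1 i2 i3 i4 i5"
        fst "\<lambda>i. fst (snd i)" "\<lambda>i. fst (snd (snd i))" "\<lambda>i. fst (snd (snd (snd i)))"
        "\<lambda>i. snd (snd (snd (snd i)))"])
      (simp_all add: h sum.cartesian_product case_prod_unfold)
qed

lemma poly5_monom: "poly5 (\<lambda>x1 x2 x3 x4 x5. c * x1 ^ i1 * x2 ^ i2 * x3 ^ i3 * x4 ^ i4 * x5 ^ i5)"
  by (rule poly5I[of "{()}" _ "\<lambda>_. c" "\<lambda>_. i1" "\<lambda>_. i2" "\<lambda>_. i3" "\<lambda>_. i4" "\<lambda>_. i5"]) auto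

lemma poly5_add:
  assumes "poly5 f" "poly5 g"
  shows "poly5 (\<lambda>x1 x2 x3 x4 x5. f x1 x2 x3 x4 x5 + g x1 x2 x3 x4 x5)"
proof -
  obtain J :: "(nat \<times> nat \<times> nat \<times> nat \<times> nat) set" and c e1 e2 e3 e4 e5
    where J: "finite J" and f: "\<And>x1 x2 x3 x4 x5. f x1 x2 x3 x4 x5 =
      (\<Sum>j\<in>J. c j * x1 ^ e1 j * x2 ^ e2 j * x3 ^ e3 j * x4 ^ e4 j * x5 ^ e5 j)"
    by (rule poly5E[OF assms(1)], rule that)
  obtain J' :: "(nat \<times> nat \<times> nat \<times> nat \<times> nat) set" and c' e1' e2' e3' e4' e5'
    where J': "finite J'" and g: "\<And>x1 x2 x3 x4 x5. g x1 x2 x3 x4 x5 =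
      (\<Sum>j\<in>J'. c' j * x1 ^ e1' j * x2 ^ e2' j * x3 ^ e3' j * x4 ^ e4' j * x5 ^ e5' j)"
    by (rule poly5E[OF assms(2)], rule that)
  show ?thesis
    by (rule poly5I[of "J <+> J'" _ "case_sum c c'" "case_sum e1 e1'" "case_sum e2 e2'"
          "case_sum e3 e3'" "case_sum e4 e4'" "case_sum e5 e5'"])
      (use J J' in \<open>simp_all add: f g sum.Plus\<close>)
qed

lemma poly5_mult:
  assumes "poly5 f" "poly5 g"
  shows "poly5 (\<lambda>x1 x2 x3 x4 x5. f x1 x2 x3 x4 x5 * g x1 x2 x3 x4 x5)"
proof -
  obtain J :: "(nat \<times> nat \<times> nat \<times> nat \<times> nat) set" and c e1 e2 e3 e4 e5
    where J: "finite J" and f: "\<And>x1 x2 x3 x4 x5. f x1 x2 x3 x4 x5 =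
      (\<Sum>j\<in>J. c j * x1 ^ e1 j * x2 ^ e2 j * x3 ^ e3 j * x4 ^ e4 j * x5 ^ e5 j)"
    by (rule poly5E[OF assms(1)], rule that)
  obtain J' :: "(nat \<times> nat \<times> nat \<times> nat \<times> nat) set" and c' e1' e2' e3' e4' e5'
    where J': "finite J'" and g: "\<And>x1 x2 x3 x4 x5. g x1 x2 x3 x4 x5 =
      (\<Sum>j\<in>J'. c' j * x1 ^ e1' j * x2 ^ e2' j * x3 ^ e3' j * x4 ^ e4' j * x5 ^ e5' j)"
    by (rule poly5E[OF assms(2)], rule that)
  show ?thesis
    by (rule poly5I[of "J \<times> J'" _ "\<lambda>(i, j). c i * c' j" "\<lambda>(i, j). e1 i + e1' j" "\<lambda>(i, j). e2 i + e2' j"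
          "\<lambda>(i, j). e3 i + e3' j" "\<lambda>(i, j). e4 i + e4' j" "\<lambda>(i, j). e5 i + e5' j"])
      (use J J' in \<open>simp_all add: f g sum_product sum.cartesian_product case_prod_unfold\<close>,
        simp add: power_add mult_ac)
qed

lemma poly5_const: "poly5 (\<lambda>x1 x2 x3 x4 x5. c)"
  using poly5_monom[of c 0 0 0 0 0] by simp

lemma poly5_proj:
  "poly5 (\<lambda>x1 x2 x3 x4 x5. x1)" "poly5 (\<lambda>x1 x2 x3 x4 x5. x2)" "poly5 (\<lambda>x1 x2 x3 x4 x5. x3)"
  "poly5 (\<lambda>x1 x2 x3 x4 x5. x4)" "poly5 (\<lambda>x1 x2 x3 x4 x5. x5)"
  using poly5_monom[of 1 1 0 0 0 0] poly5_monom[of 1 0 1 0 0 0] poly5_monom[of 1 0 0 1 0 0]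
    poly5_monom[of 1 0 0 0 1 0] poly5_monom[of 1 0 0 0 0 1] by simp_all

lemma poly5_power:
  assumes "poly5 f"
  shows "poly5 (\<lambda>x1 x2 x3 x4 x5. f x1 x2 x3 x4 x5 ^ n)"
  by (induction n) (simp_all add: poly5_const poly5_mult assms)

lemmas poly5_intros = poly5_add poly5_mult poly5_const poly5_proj poly5_power

section \<open>Covering numbers of network classes\<close>

lemma clip_bound: "D \<ge> 0 \<Longrightarrow> \<bar>clip D x\<bar> \<le> D"
  by (auto simp: clip_def sgn_if min_def)

lemma clip_lipschitz: "D \<ge> 0 \<Longrightarrow> \<bar>clip D x - clip D y\<bar> \<le> \<bar>x - y\<bar>"
  by (auto simp: clip_def sgn_if min_def abs_if split: if_splits)

text \<open>Since \<open>s \<ge> 1\<close>, the bias acts like one more weight on an input of size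
  at most \<open>s\<close>, which accounts for \<open>n + 1\<close>. The bound \<open>Q\<close> is
  meant to be common to all layers, so that it can be iterated.\<close>

lemma affine_bound:
  assumes x: "\<And>k. k < n \<Longrightarrow> \<bar>x k\<bar> \<le> s" and s: "s \<ge> 1"
    and A: "\<And>k. k < n \<Longrightarrow> \<bar>fst l j k\<bar> \<le> r" and b: "\<bar>snd l j\<bar> \<le> r" and r: "r \<ge> 0"
    and Q: "(real n + 1) * r \<le> Q"
  shows "\<bar>affine n l x j\<bar> \<le> Q * s"
proof -
  have "\<bar>affine n l x j\<bar> \<le> (\<Sum>k<n. \<bar>fst l j k * x k\<bar>) + \<bar>snd l j\<bar>"
    unfolding affine_def by (intro order.trans[OF abs_triangle_ineq] add_right_mono sum_abs)
  also have "\<dots> \<le> (\<Sum>k<n. r * s) + r * s"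
  proof (intro add_mono sum_mono)
    show "\<bar>snd l j\<bar> \<le> r * s" using b r s mult_left_mono[of 1 s r] by simp
    fix k assume "k \<in> {..<n}"
    then show "\<bar>fst l j k * x k\<bar> \<le> r * s"
      unfolding abs_mult using x A r by (intro mult_mono) auto
  qed
  also have "\<dots> = (real n + 1) * r * s" by (simp add: algebra_simps)
  also have "\<dots> \<le> Q * s" using Q s by (intro mult_right_mono) auto
  finally show ?thesis .
qed

text \<open>The splitting \<open>A x - A' x' = (A - A') x + A' (x - x')\<close> needs size bounds
  only for \<open>x\<close> and \<open>A'\<close>. The condition \<open>r \<ge> 1\<close> allows
  \<open>\<delta> * s\<close> to be enlarged to \<open>r * (\<delta> * s)\<close>, so that
  \<open>Q\<close> factors out.\<close>

lemma affine_perturbation: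
  assumes x: "\<And>k. k < n \<Longrightarrow> \<bar>x k\<bar> \<le> s" and s: "s \<ge> 1"
    and xx': "\<And>k. k < n \<Longrightarrow> \<bar>x k - x' k\<bar> \<le> t" and t: "t \<ge> 0"
    and A': "\<And>k. k < n \<Longrightarrow> \<bar>fst l' j k\<bar> \<le> r" and r: "r \<ge> 1"
    and A: "\<And>k. k < n \<Longrightarrow> \<bar>fst l j k - fst l' j k\<bar> \<le> \<delta>"
    and b: "\<bar>snd l j - snd l' j\<bar> \<le> \<delta>"
    and Q: "(real n + 1) * r \<le> Q"
  shows "\<bar>affine n l x j - affine n l' x' j\<bar> \<le> Q * (t + \<delta> * s)"
proof -
  have \<delta>: "\<delta> \<ge> 0" using b by linarith
  have "affine n l x j - affine n l' x' j
      = (\<Sum>k<n. (fst l j k - fst l' j k) * x k + fst l' j k * (x k - x' k)) + (snd l j - snd l' j)"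
    unfolding affine_def by (simp add: algebra_simps sum.distrib sum_subtractf)
  also have "\<bar>\<dots>\<bar> \<le> (\<Sum>k<n. \<bar>(fst l j k - fst l' j k) * x k + fst l' j k * (x k - x' k)\<bar>) + \<bar>snd l j - snd l' j\<bar>"
    by (intro order.trans[OF abs_triangle_ineq] add_right_mono sum_abs)
  also have "\<dots> \<le> (\<Sum>k<n. \<delta> * s + r * t) + \<delta> * s"
  proof (intro add_mono sum_mono)
    fix k assume "k \<in> {..<n}"
    then show "\<bar>(fst l j k - fst l' j k) * x k + fst l' j k * (x k - x' k)\<bar> \<le> \<delta> * s + r * t"
      using A A' x xx' r s t \<delta>
      by (intro order.trans[OF abs_triangle_ineq] add_mono; unfold abs_mult; intro mult_mono) auto
  next
    show "\<bar>snd l j - snd l' j\<bar> \<le> \<delta> * s"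
      using b s \<delta> mult_left_mono[of 1 s \<delta>] by simp
  qed
  also have "\<dots> \<le> (\<Sum>k<n. r * (\<delta> * s) + r * t) + (r * (\<delta> * s) + r * t)"
  proof (intro add_mono sum_mono order.refl)
    show le: "\<delta> * s \<le> r * (\<delta> * s)" using r s \<delta> mult_right_mono[of 1 r "\<delta> * s"] by simp
    have "0 \<le> r * t" using r t by simp
    with le show "\<delta> * s \<le> r * (\<delta> * s) + r * t" by linarith
  qed
  also have "\<dots> = (real n + 1) * r * (t + \<delta> * s)" by (simp add: algebra_simps)
  also have "\<dots> \<le> Q * (t + \<delta> * s)" using Q s t \<delta> by (intro mult_right_mono) auto
  finally show ?thesis .
qed

text \<open>Layers are total functions, so only the entries that the architecture \<open>a\<close>
  uses are compared.\<close>

definition params_close :: "nat list \<Rightarrow> real \<Rightarrow> layer list \<Rightarrow> layer list \<Rightarrow> bool" where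
  "params_close a \<delta> \<theta> \<theta>' \<longleftrightarrow> (\<forall>l<length a - 1. \<forall>j<a ! (l + 1).
     \<bar>snd (\<theta> ! l) j - snd (\<theta>' ! l) j\<bar> \<le> \<delta> \<and>
     (\<forall>k<a ! l. \<bar>fst (\<theta> ! l) j k - fst (\<theta>' ! l) j k\<bar> \<le> \<delta>))"

lemma param_ok_Cons:
  "param_ok (n0 # n1 # ns) r (l # ls) \<longleftrightarrow>
     (\<forall>j<n1. \<bar>snd l j\<bar> \<le> r \<and> (\<forall>k<n0. \<bar>fst l j k\<bar> \<le> r)) \<and> param_ok (n1 # ns) r ls"
  by (auto simp: param_ok_def All_less_Suc2)

lemma params_close_Cons:
  "params_close (n0 # n1 # ns) \<delta> (l # ls) (l' # ls') \<longleftrightarrow>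
     (\<forall>j<n1. \<bar>snd l j - snd l' j\<bar> \<le> \<delta> \<and> (\<forall>k<n0. \<bar>fst l j k - fst l' j k\<bar> \<le> \<delta>)) \<and>
     params_close (n1 # ns) \<delta> ls ls'"
  by (auto simp: params_close_def All_less_Suc2)

text \<open>Induction over the layers. One layer replaces the input bound \<open>s\<close> by
  \<open>Q * s\<close> and the input error \<open>t\<close> by
  \<open>Q * (t + \<delta> * s)\<close>, and ReLU increases neither. Allowing different inputs
  \<open>x\<close> and \<open>x'\<close> is what lets the induction pass to the hidden layers,
  although both networks are finally applied to one point.\<close>

lemma net_eval_perturbation:
  assumes "length a \<ge> 2" and "param_ok a r \<theta>" and "param_ok a r \<theta>'" and "params_close a \<delta> \<theta> \<theta>'"
    and "\<And>n. n \<in> set a \<Longrightarrow> (real n + 1) * r \<le> Q" and "r \<ge> 1" and "Q \<ge> 1" and "\<delta> \<ge> 0"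
    and "\<And>k. k < hd a \<Longrightarrow> \<bar>x k\<bar> \<le> s" and "s \<ge> 1"
    and "\<And>k. k < hd a \<Longrightarrow> \<bar>x k - x' k\<bar> \<le> t" and "t \<ge> 0"
    and "j < last a"
  shows "\<bar>net_eval a \<theta> x j - net_eval a \<theta>' x' j\<bar> \<le> Q ^ (length a - 1) * (t + real (length a - 1) * \<delta> * s)"
  using assms
proof (induction a arbitrary: \<theta> \<theta>' x x' s t rule: induct_list012)
  case (3 n0 n1 ns)
  from 3(4) obtain l ls where \<theta>: "\<theta> = l # ls" by (auto simp: param_ok_def length_Suc_conv)
  from 3(5) obtain l' ls' where \<theta>': "\<theta>' = l' # ls'" by (auto simp: param_ok_def length_Suc_conv)
  have l: "\<bar>snd l j\<bar> \<le> r" "k < n0 \<Longrightarrow> \<bar>fst l j k\<bar> \<le> r"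
    and l': "\<bar>snd l' j\<bar> \<le> r" "k < n0 \<Longrightarrow> \<bar>fst l' j k\<bar> \<le> r" 
    and ll': "\<bar>snd l j - snd l' j\<bar> \<le> \<delta>" "k < n0 \<Longrightarrow> \<bar>fst l j k - fst l' j k\<bar> \<le> \<delta>"
    if "j < n1" for j k
    using 3(4,5,6) that unfolding \<theta> \<theta>' param_ok_Cons params_close_Cons by blast+
  have Q: "(real n0 + 1) * r \<le> Q" using 3(7) by auto
  have pert: "\<bar>affine n0 l x j - affine n0 l' x' j\<bar> \<le> Q * (t + \<delta> * s)" if "j < n1" for j
    using 3(8-14) l' ll' that Q by (intro affine_perturbation[where r = r]) auto
  show ?case
  \<comment> \<open>The last affine map has no activation after it and therefore forms the base
    case.\<close>
  proof (cases ns)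
    case Nil
    with \<theta> \<theta>' 3(4,5) have "ls = []" "ls' = []" by (auto simp: param_ok_def)
    then show ?thesis using pert 3(15) by (simp add: \<theta> \<theta>' Nil)
  next
    case (Cons n2 ns')
    let ?y = "relu_vec (affine n0 l x)" and ?y' = "relu_vec (affine n0 l' x')"
    have ok: "param_ok (n1 # ns) r ls" "param_ok (n1 # ns) r ls'" "params_close (n1 # ns) \<delta> ls ls'"
      using 3(4,5,6) unfolding \<theta> \<theta>' param_ok_Cons params_close_Cons by blast+
    have "\<bar>net_eval (n1 # ns) ls ?y j - net_eval (n1 # ns) ls' ?y' j\<bar>
        \<le> Q ^ (length (n1 # ns) - 1) * (Q * (t + \<delta> * s) + real (length (n1 # ns) - 1) * \<delta> * (Q * s))"
    proof (rule 3(2))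
      fix k assume k: "k < hd (n1 # ns)"
      have "\<bar>affine n0 l x k\<bar> \<le> Q * s"
        using 3(8-14) l k Q by (intro affine_bound[where r = r]) auto
      then show "\<bar>?y k\<bar> \<le> Q * s" by (auto simp: relu_vec_def)
      show "\<bar>?y k - ?y' k\<bar> \<le> Q * (t + \<delta> * s)"
        using pert[of k] k by (auto simp: relu_vec_def)
    next
      show "1 \<le> Q * s" using 3(9,12) mult_mono[of 1 Q 1 s] by simp
    qed (use 3(7-15) ok in \<open>auto simp: Cons\<close>)
    also have "\<dots> = Q ^ (length (n0 # n1 # ns) - 1) * (t + real (length (n0 # n1 # ns) - 1) * \<delta> * s)"
      by (simp add: algebra_simps)
    finally show ?thesis by (simp add: \<theta> \<theta>' Cons)
  qed
qed auto

section \<open>Measurability and boundedness of the clipped networks\<close>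

lemma net_eval_measurable:
  assumes "length a \<ge> 2" and "length \<theta> = length a - 1" and "\<And>k. k < hd a \<Longrightarrow> (\<lambda>w. g w k) \<in> borel_measurable N"
  shows "(\<lambda>w. net_eval a \<theta> (g w) j) \<in> borel_measurable N"
  using assms
proof (induction a arbitrary: \<theta> g rule: induct_list012)
  case (3 n0 n1 ns)
  from 3 obtain l ls where \<theta>: "\<theta> = l # ls" by (auto simp: length_Suc_conv)
  have meas: "(\<lambda>w. affine n0 l (g w) k) \<in> borel_measurable N" for k
    using 3(5) unfolding affine_def by (intro borel_measurable_add borel_measurable_sum borel_measurable_times) auto
  show ?case
  proof (cases ns)
    case Nil
    with \<theta> 3 show ?thesis using meas by auto
  next
    case (Cons n2 ns')
    \<comment> \<open>The outputs of the first hidden layer take the place of \<open>g\<close> in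
      the induction hypothesis, which is why the lemma is stated for composed inputs.\<close>
    have "(\<lambda>w. net_eval (n1 # ns) ls (relu_vec (affine n0 l (g w))) j) \<in> borel_measurable N"
      by (rule 3(2)) (use 3(3,4) meas in \<open>auto simp: Cons \<theta> relu_vec_def\<close>)
    then show ?thesis by (simp add: \<theta> Cons)
  qed
qed auto

lemma sets_cube: "cube u v d \<in> sets (Rd d)"
  unfolding cube_def Rd_def by (intro sets_PiM_I_finite) auto

text \<open>Outside the cube, \<open>restrict\<close> yields a fixed default value, so measurability
  on all of \<open>Rd d\<close> follows from that of the unrestricted network and of the
  cube.\<close>

lemma nn_class_measurable:
  assumes "architecture d a" and "f \<in> nn_class u v a R D"
  shows "f \<in> borel_measurable (Rd d)"
proof -
  from assms obtain \<theta> where ok: "param_ok a R \<theta>"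
    and f: "f = restrict (\<lambda>x. clip D (net_eval a \<theta> x 0)) (cube u v d)"
    by (auto simp: nn_class_def architecture_def)
  have [measurable]: "(\<lambda>x. net_eval a \<theta> x 0) \<in> borel_measurable (Rd d)"
    using assms ok
    by (intro net_eval_measurable) (auto simp: architecture_def param_ok_def Rd_def)
  have [measurable]: "(\<lambda>x. clip D (net_eval a \<theta> x 0)) \<in> borel_measurable (Rd d)"
    unfolding clip_def by measurable
  have [measurable]: "Measurable.pred (Rd d) (\<lambda>x. x \<in> cube u v d)"
    using sets_cube by (intro pred_sets2[OF sets_cube]) auto
  show ?thesis unfolding f restrict_def by measurable
qed

lemma nn_class_bound:
  assumes "architecture d a" "f \<in> nn_class u v a R D" "D \<ge> 0" "x \<in> cube u v d"
  shows "\<bar>f x\<bar> \<le> D"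
  using assms by (auto simp: nn_class_def architecture_def clip_bound)

section \<open>Rounding of parameters and the resulting finite net\<close>

definition round_to :: "real \<Rightarrow> real \<Rightarrow> real" where
  "round_to \<delta> x = \<delta> * (sgn x * of_int \<lfloor>\<bar>x\<bar> / \<delta>\<rfloor>)"

lemma round_to_close: "\<delta> > 0 \<Longrightarrow> \<bar>x - round_to \<delta> x\<bar> \<le> \<delta>"
proof -
  assume "\<delta> > 0"
  then have "of_int \<lfloor>\<bar>x\<bar> / \<delta>\<rfloor> * \<delta> \<le> \<bar>x\<bar>" 
    by (metis of_int_floor_le pos_le_divide_eq)
  moreover have "\<bar>x\<bar> / \<delta> < of_int \<lfloor>\<bar>x\<bar> / \<delta>\<rfloor> + 1" by linarith
  then have "\<bar>x\<bar> < of_int \<lfloor>\<bar>x\<bar> / \<delta>\<rfloor> * \<delta> + \<delta>" using \<open>\<delta> > 0\<close>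
    by (simp add: pos_divide_less_eq algebra_simps)
  ultimately show ?thesis using \<open>\<delta> > 0\<close>
    by (auto simp: round_to_def sgn_if mult.commute abs_if split: if_splits)
qed

definition grid :: "real \<Rightarrow> real \<Rightarrow> real set" where
  "grid \<delta> R = (\<lambda>k. \<delta> * of_int k) ` {- \<lfloor>R / \<delta>\<rfloor>..\<lfloor>R / \<delta>\<rfloor>}"

text \<open>Rounding goes towards zero and hence never increases the absolute value. This keeps the
  rounded parameters within \<open>R\<close>, so that the net will lie inside the class
  itself.\<close>

lemma round_to_grid:
  assumes "\<delta> > 0" "\<bar>x\<bar> \<le> R"
  shows "round_to \<delta> x \<in> grid \<delta> R"
proof -
  define k where "k = \<lfloor>\<bar>x\<bar> / \<delta>\<rfloor>"
  have k: "k \<le> \<lfloor>R / \<delta>\<rfloor>" "0 \<le> k"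
    using assms by (auto simp: k_def intro!: floor_mono divide_right_mono)
  have "sgn x * of_int k \<in> real_of_int ` {- \<lfloor>R / \<delta>\<rfloor>..\<lfloor>R / \<delta>\<rfloor>}"
  proof (cases x "0 :: real" rule: linorder_cases)
    case less
    then show ?thesis using k by (intro image_eqI[where x = "- k"]) auto
  next
    case equal
    then show ?thesis using k by (intro image_eqI[where x = 0]) (auto simp del: zero_le_floor)
  next
    case greater
    then show ?thesis using k by (intro image_eqI[where x = k]) auto
  qed
  then show ?thesis by (auto simp: grid_def round_to_def k_def)
qed

lemma grid_abs_le:
  assumes "\<delta> > 0" "y \<in> grid \<delta> R"
  shows "\<bar>y\<bar> \<le> R"
proof -
  from assms obtain k where y: "y = \<delta> * of_int k" and k: "\<bar>k\<bar> \<le> \<lfloor>R / \<delta>\<rfloor>"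
    unfolding grid_def by force
  then have "of_int \<bar>k\<bar> \<le> R / \<delta>" by (simp add: le_floor_iff)
  then have "of_int \<bar>k\<bar> * \<delta> \<le> R" using assms by (simp add: pos_le_divide_eq)
  then show ?thesis using assms by (simp add: y abs_mult mult.commute)
qed

lemma finite_grid: "finite (grid \<delta> R)"
  by (simp add: grid_def)

lemma card_grid:
  assumes "\<delta> > 0" "R \<ge> 0"
  shows "real (card (grid \<delta> R)) \<le> 2 * R / \<delta> + 1"
proof -
  have 0: "0 \<le> \<lfloor>R / \<delta>\<rfloor>" using assms by simp
  have "card (grid \<delta> R) \<le> card {- \<lfloor>R / \<delta>\<rfloor>..\<lfloor>R / \<delta>\<rfloor>}"
    unfolding grid_def by (rule card_image_le) simp
  also have "\<dots> = nat (2 * \<lfloor>R / \<delta>\<rfloor> + 1)" by (simp add: algebra_simps)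
  finally have "real (card (grid \<delta> R)) \<le> real (nat (2 * \<lfloor>R / \<delta>\<rfloor> + 1))" by (rule of_nat_mono)
  also have "\<dots> = 2 * of_int \<lfloor>R / \<delta>\<rfloor> + 1" using 0 by simp
  also have "\<dots> \<le> 2 * (R / \<delta>) + 1"
    by (intro add_mono mult_left_mono of_int_floor_le) auto
  finally show ?thesis by simp
qed

text \<open>In the flat index set, the entries of layer \<open>l\<close> with last component \<open>a ! l\<close> are the biases.\<close>

definition param_index :: "nat list \<Rightarrow> (nat \<times> nat \<times> nat) set" where
  "param_index a = (SIGMA l:{..<length a - 1}. {..<a ! (l + 1)} \<times> {..a ! l})"

definition params_of :: "nat list \<Rightarrow> (nat \<times> nat \<times> nat \<Rightarrow> real) \<Rightarrow> layer list" where
  "params_of a p = map (\<lambda>l. (\<lambda>j k. p (l, j, k), \<lambda>j. p (l, j, a ! l))) [0..<length a - 1]"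

lemma finite_param_index: "finite (param_index a)"
  by (simp add: param_index_def)

lemma card_param_index: "card (param_index a) = num_params a"
proof -
  have "num_params a = (\<Sum>l\<in>{1..<length a}. a ! l * (a ! (l - 1) + 1))" by (simp add: num_params_def)
  also have "\<dots> = (\<Sum>l\<in>{..<length a - 1}. a ! (l + 1) * (a ! l + 1))"
    \<comment> \<open>\<open>num_params\<close> numbers the layers from 1, whereas the parameter
      list starts at 0.\<close>
    by (rule sum.reindex_bij_witness[of _ "\<lambda>l. l + 1" "\<lambda>l. l - 1"]) auto
  finally show ?thesis by (simp add: param_index_def card_cartesian_product)
qed

text \<open>Depth, widths and input dimension can thereby all be replaced by the single quantity
  \<open>num_params a\<close>. The depth bound holds because every layer contributes at least one
  parameter.\<close>

lemma num_params_ge: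
  assumes "architecture d a"
  shows "length a - 1 \<le> num_params a" and "n \<in> set a \<Longrightarrow> n \<le> num_params a" and "d \<le> num_params a"
proof -
  have pos: "a ! l \<ge> 1" if "l < length a" for l using assms that by (auto simp: architecture_def)
  have summand: "a ! l * (a ! (l - 1) + 1) \<le> num_params a" if "l \<in> {1..<length a}" for l
    unfolding num_params_def by (rule member_le_sum[OF that]) auto
  have "length a - 1 = (\<Sum>l\<in>{1..<length a}. 1)" by simp
  also have "\<dots> \<le> num_params a"
    unfolding num_params_def by (intro sum_mono) (use pos in \<open>auto simp: Suc_le_eq\<close>)
  finally show "length a - 1 \<le> num_params a" .
  show *: "n \<le> num_params a" if n: "n \<in> set a" for n
  proof -
    obtain l where l: "l < length a" "n = a ! l" using n by (auto simp: in_set_conv_nth)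
    show ?thesis
    \<comment> \<open>The input width occurs only as a number of columns; every other width occurs
      as a number of rows.\<close>
    proof (cases l)
      case 0
      have "n * 1 \<le> (a ! 0 + 1) * a ! 1" using l 0 pos[of 1] assms
        by (intro mult_mono) (auto simp: architecture_def)
      also have "\<dots> \<le> num_params a" using summand[of 1] assms by (auto simp: architecture_def mult.commute)
      finally show ?thesis by simp
    next
      case (Suc l')
      have "n * 1 \<le> a ! l * (a ! (l - 1) + 1)" using l by (intro mult_mono) auto
      also have "\<dots> \<le> num_params a" using summand[of l] l Suc by auto
      finally show ?thesis by simp
    qed
  qed
  show "d \<le> num_params a" using assms by (intro *) (auto simp: architecture_def intro!: hd_in_set)
qed

text \<open>The net consists of the networks with parameters in \<open>grid \<delta> R\<close>. The
  auxiliary bound \<open>r\<close> enters because the perturbation estimate wants a parameter bound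
  of at least 1, while \<open>R\<close> may be small; the cardinality bound still involves
  \<open>R\<close> itself.\<close>

lemma nn_class_net:
  assumes a: "architecture d a" and R: "R > 0" and D: "D > 0" and \<delta>: "\<delta> > 0"
    and r: "r \<ge> 1" "R \<le> r" and s: "s \<ge> 1" "\<bar>u\<bar> \<le> s" "\<bar>v\<bar> \<le> s"
    and Q: "Q = (real (num_params a) + 1) * r"
  obtains F where "finite F" "F \<subseteq> nn_class u v a R D"
    "real (card F) \<le> (2 * R / \<delta> + 1) ^ num_params a"
    "\<And>f. f \<in> nn_class u v a R D \<Longrightarrow> \<exists>g\<in>F. \<forall>x\<in>cube u v d.
       \<bar>f x - g x\<bar> \<le> real (num_params a) * Q ^ num_params a * s * \<delta>"
proof
  let ?\<Phi> = "\<lambda>\<theta>. restrict (\<lambda>x. clip D (net_eval a \<theta> x 0)) (cube u v d)"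
  let ?G = "param_index a \<rightarrow>\<^sub>E grid \<delta> R"
  have hd: "hd a = d" and len: "length a \<ge> 2" and last: "last a = 1" using a by (auto simp: architecture_def)
  define F where "F = (\<lambda>p. ?\<Phi> (params_of a p)) ` ?G"
  have finG: "finite ?G" by (intro finite_PiE finite_param_index finite_grid)
  show "finite F" using finG by (simp add: F_def)
  show "F \<subseteq> nn_class u v a R D"
  proof
    fix f assume "f \<in> F"
    then obtain p where p: "p \<in> ?G" "f = ?\<Phi> (params_of a p)" by (auto simp: F_def)
    have "param_ok a R (params_of a p)"
      using p(1) grid_abs_le[OF \<delta>] by (auto simp: param_ok_def params_of_def param_index_def PiE_iff)
    then show "f \<in> nn_class u v a R D" using p(2) hd by (auto simp: nn_class_def)
  qed
  have "card F \<le> card ?G" unfolding F_def by (rule card_image_le[OF finG])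
  also have "\<dots> = card (grid \<delta> R) ^ num_params a"
    by (subst card_PiE) (auto simp: finite_param_index card_param_index)
  finally have "real (card F) \<le> real (card (grid \<delta> R)) ^ num_params a"
    by (metis of_nat_le_iff of_nat_power)
  also have "\<dots> \<le> (2 * R / \<delta> + 1) ^ num_params a"
    using card_grid[OF \<delta>] R by (intro power_mono) auto
  finally show "real (card F) \<le> (2 * R / \<delta> + 1) ^ num_params a" .
  fix f assume "f \<in> nn_class u v a R D"
  then obtain \<theta> where ok: "param_ok a R \<theta>" and f: "f = ?\<Phi> \<theta>" using hd by (auto simp: nn_class_def)
  \<comment> \<open>Column \<open>a ! l\<close> of layer \<open>l\<close> carries the bias, in
    accordance with \<open>params_of\<close>.\<close>
  define p where "p = restrict (\<lambda>(l, j, k).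
     round_to \<delta> (if k < a ! l then fst (\<theta> ! l) j k else snd (\<theta> ! l) j)) (param_index a)"
  have pG: "p \<in> ?G"
    using ok by (auto simp: p_def param_index_def param_ok_def intro!: round_to_grid \<delta>)
  have ok': "param_ok a R (params_of a p)"
    using pG grid_abs_le[OF \<delta>] by (auto simp: param_ok_def params_of_def param_index_def PiE_iff)
  have close: "params_close a \<delta> \<theta> (params_of a p)"
    using round_to_close[OF \<delta>]
    by (auto simp: params_close_def params_of_def p_def param_index_def)
  have mono: "param_ok a r \<theta>" if "param_ok a R \<theta>" for \<theta>
    using that r unfolding param_ok_def by (meson order_trans)
  let ?P = "num_params a"
  have Q1: "Q \<ge> 1" unfolding Q using r mult_mono[of 1 "real ?P + 1" 1 r] by simp
  show "\<exists>g\<in>F. \<forall>x\<in>cube u v d. \<bar>f x - g x\<bar> \<le> real ?P * Q ^ ?P * s * \<delta>"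
  proof (intro bexI ballI)
    show "?\<Phi> (params_of a p) \<in> F" using pG by (auto simp: F_def)
    fix x assume x: "x \<in> cube u v d"
    have "\<bar>f x - ?\<Phi> (params_of a p) x\<bar> \<le> \<bar>net_eval a \<theta> x 0 - net_eval a (params_of a p) x 0\<bar>"
      using x D by (simp add: f clip_lipschitz)
    \<comment> \<open>Both networks receive the same \<open>x\<close>, so the initial input error is
      0.\<close>
    also have "\<dots> \<le> Q ^ (length a - 1) * (0 + real (length a - 1) * \<delta> * s)"
    proof (rule net_eval_perturbation[where r = r])
      fix k assume "k < hd a"
      then have "u \<le> x k" "x k \<le> v" using x hd by (auto simp: cube_def PiE_iff)
      then show "\<bar>x k\<bar> \<le> s" using s by linarith
    next
      fix n assume "n \<in> set a"
      then have "n \<le> ?P" using num_params_ge[OF a] by auto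
      then show "(real n + 1) * r \<le> Q" unfolding Q using r by (intro mult_right_mono) auto
    qed (use len ok ok' mono close r Q1 \<delta> s last in auto)
    also have "\<dots> \<le> Q ^ ?P * (real ?P * \<delta> * s)"
      using num_params_ge(1)[OF a] Q1 \<delta> s
      by (auto intro!: mult_mono power_increasing)
    finally show "\<bar>f x - ?\<Phi> (params_of a p) x\<bar> \<le> real ?P * Q ^ ?P * s * \<delta>" by (simp add: mult_ac)
  qed
qed

section \<open>Moments from log-normal tails\<close>

text \<open>The quadratic exponent eventually wins: once \<open>c * n \<ge> p + 1\<close>, the terms
  are dominated by a geometric series of ratio \<open>exp (- 1)\<close>.\<close>

lemma summable_exp_linear_minus_square:
  fixes c :: real
  assumes "c > 0"
  shows "summable (\<lambda>n. exp (p * real (n + 1)) * (2 * exp (- c * (real n)\<^sup>2)))"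
proof (rule summable_comparison_test_ev)
  obtain N :: nat where N: "real N \<ge> (p + 1) / c" using real_arch_simple by blast
  show "eventually (\<lambda>n. norm (exp (p * real (n + 1)) * (2 * exp (- c * (real n)\<^sup>2))) \<le> 2 * exp p * exp (- 1) ^ n) sequentially"
    using eventually_ge_at_top[of N]
  proof eventually_elim
    case (elim n)
    have "(p + 1) / c \<le> real n" using elim N by linarith
    then have "p + 1 \<le> c * real n" using assms by (simp add: field_simps)
    then have "(p + 1) * real n \<le> c * real n * real n" by (intro mult_right_mono) auto
    then have "p * real (n + 1) - c * (real n)\<^sup>2 \<le> p + - 1 * real n"
      by (simp add: power2_eq_square algebra_simps)
    then have "exp (p * real (n + 1) - c * (real n)\<^sup>2) \<le> exp (p + real n * - 1)" by simp
    also have "\<dots> = exp p * exp (- 1) ^ n" by (simp only: exp_add exp_of_nat_mult)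
    finally show ?case by (simp add: exp_diff exp_minus field_simps)
  qed
  show "summable (\<lambda>n. 2 * exp p * exp (- 1 :: real) ^ n)"
    by (intro summable_mult summable_geometric) simp
qed

text \<open>If \<open>\<bar>z\<bar> \<ge> 1\<close>, the single layer
  \<open>n = \<lfloor>ln \<bar>z\<bar>\<rfloor>\<close> already dominates; the summand 1 covers
  smaller values. Nested superlevel sets are used in place of disjoint shells because the tail
  condition speaks of exactly these sets.\<close>

lemma power_le_exp_layers:
  fixes z :: real
  shows "ennreal (\<bar>z\<bar> ^ p) \<le> 1 + (\<Sum>n. ennreal (exp (real p * real (n + 1))) * indicator {z. exp (real n) \<le> \<bar>z\<bar>} z)"
proof (cases "\<bar>z\<bar> < 1")
  case True
  then have "\<bar>z\<bar> ^ p \<le> 1" by (intro power_le_one) auto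
  then have "ennreal (\<bar>z\<bar> ^ p) \<le> 1" by simp
  then show ?thesis by (rule order.trans) simp
next
  case False
  define n where "n = nat \<lfloor>ln \<bar>z\<bar>\<rfloor>"
  have n: "real n \<le> ln \<bar>z\<bar>" "ln \<bar>z\<bar> \<le> real (n + 1)" using False unfolding n_def by auto linarith
  have zn: "exp (real n) \<le> \<bar>z\<bar>" using n(1) False by (simp add: ln_ge_iff)
  have "\<bar>z\<bar> \<le> exp (real (n + 1))"
    using n(2) False by (metis exp_ln exp_le_cancel_iff not_less less_le_trans zero_less_one)
  then have "\<bar>z\<bar> ^ p \<le> exp (real (n + 1)) ^ p" by (intro power_mono) auto
  also have "\<dots> = exp (real p * real (n + 1))" by (simp only: exp_of_nat_mult)
  finally have le: "\<bar>z\<bar> ^ p \<le> exp (real p * real (n + 1))" .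
  let ?s = "\<lambda>n. ennreal (exp (real p * real (n + 1))) * indicator {z. exp (real n) \<le> \<bar>z\<bar>} z"
  have "ennreal (\<bar>z\<bar> ^ p) \<le> ?s n" using zn le by (simp add: ennreal_leI)
  also have "?s n = sum ?s {n}" by (simp only: sum.insert finite.emptyI empty_iff sum.empty add_0_right not_False_eq_True)
  also have "\<dots> \<le> suminf ?s" by (rule sum_le_suminf) auto
  finally show ?thesis by (rule order.trans) simp
qed

text \<open>At the levels \<open>t = exp n\<close> the tail bound reads
  \<open>2 * exp (- c * n^2)\<close>, so the layer sum converges for every \<open>p\<close>. The
  constant \<open>A\<close> is fixed before \<open>Z\<close>, hence it is uniform over all
  dimensions and coordinates.\<close>

lemma (in prob_space) lognormal_tail_moment:
  assumes c: "c > 0"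
  obtains A :: real where "A \<ge> 0"
    "\<And>Z. random_variable borel Z \<Longrightarrow>
      (\<And>t. t \<ge> 1 \<Longrightarrow> prob {\<omega> \<in> space M. \<bar>Z \<omega>\<bar> \<ge> t} \<le> 2 * exp (- c * (ln t)\<^sup>2)) \<Longrightarrow>
      integrable M (\<lambda>\<omega>. \<bar>Z \<omega>\<bar> ^ p) \<and> expectation (\<lambda>\<omega>. \<bar>Z \<omega>\<bar> ^ p) \<le> A"
proof
  let ?a = "\<lambda>n. exp (real p * real (n + 1)) * (2 * exp (- c * (real n)\<^sup>2))"
  define A where "A = 1 + (\<Sum>n. ?a n)"
  have summ: "summable ?a" by (rule summable_exp_linear_minus_square[OF c])
  then show A0: "A \<ge> 0" unfolding A_def by (intro add_nonneg_nonneg suminf_nonneg) auto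
  fix Z :: "'a \<Rightarrow> real" assume Z [measurable]: "random_variable borel Z"
    and tail: "\<And>t. t \<ge> 1 \<Longrightarrow> prob {\<omega> \<in> space M. \<bar>Z \<omega>\<bar> \<ge> t} \<le> 2 * exp (- c * (ln t)\<^sup>2)"
  have "(\<integral>\<^sup>+\<omega>. ennreal (\<bar>Z \<omega>\<bar> ^ p) \<partial>M)
      \<le> (\<integral>\<^sup>+\<omega>. 1 + (\<Sum>n. ennreal (exp (real p * real (n + 1))) * indicator {\<omega>\<in>space M. exp (real n) \<le> \<bar>Z \<omega>\<bar>} \<omega>) \<partial>M)"
    by (intro nn_integral_mono order.trans[OF power_le_exp_layers]) (simp add: indicator_def)
  also have "\<dots> = 1 + (\<Sum>n. ennreal (exp (real p * real (n + 1))) * emeasure M {\<omega>\<in>space M. exp (real n) \<le> \<bar>Z \<omega>\<bar>})"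
    by (simp add: nn_integral_add nn_integral_suminf nn_integral_cmult emeasure_space_1)
  also have "\<dots> \<le> 1 + (\<Sum>n. ennreal (?a n))"
  proof (intro add_left_mono suminf_le allI)
    fix n
    have "emeasure M {\<omega>\<in>space M. exp (real n) \<le> \<bar>Z \<omega>\<bar>} \<le> ennreal (2 * exp (- c * (real n)\<^sup>2))"
      unfolding emeasure_eq_measure using tail[of "exp (real n)"] by (intro ennreal_leI) simp
    then show "ennreal (exp (real p * real (n + 1))) * emeasure M {\<omega>\<in>space M. exp (real n) \<le> \<bar>Z \<omega>\<bar>} \<le> ennreal (?a n)"
      by (subst ennreal_mult) (auto intro: mult_left_mono)
  qed auto
  also have "\<dots> = ennreal A"
    unfolding A_def using summ
    by (subst suminf_ennreal2) (auto simp: ennreal_plus suminf_nonneg simp flip: ennreal_1)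
  finally have le: "(\<integral>\<^sup>+\<omega>. ennreal (\<bar>Z \<omega>\<bar> ^ p) \<partial>M) \<le> ennreal A" .
  have int: "integrable M (\<lambda>\<omega>. \<bar>Z \<omega>\<bar> ^ p)"
    using le by (intro integrableI_bounded) (auto simp: less_top[symmetric] top_unique)
  moreover have "expectation (\<lambda>\<omega>. \<bar>Z \<omega>\<bar> ^ p) \<le> A"
    using le nn_integral_eq_integral[OF int] A0 by (auto simp: ennreal_le_iff)
  ultimately show "integrable M (\<lambda>\<omega>. \<bar>Z \<omega>\<bar> ^ p) \<and> expectation (\<lambda>\<omega>. \<bar>Z \<omega>\<bar> ^ p) \<le> A" ..
qed

text \<open>If the norm is at most 1, the summand 1 suffices. Otherwise the real exponent may be
  raised to the natural number \<open>p\<close>, and the norm is at most \<open>d\<close> times the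
  largest \<open>\<bar>y j\<bar>\<close>. Only moments of single coordinates remain to be
  controlled.\<close>

lemma l2norm_powr_sq_le:
  assumes d: "d \<ge> 1" and q: "0 \<le> q" "2 * q \<le> real p"
  shows "(l2norm d y powr q)\<^sup>2 \<le> 1 + real d ^ p * (\<Sum>i<d. \<bar>y i\<bar> ^ p)"
proof -
  let ?n = "l2norm d y"
  have n0: "?n \<ge> 0" by (simp add: l2norm_def sum_nonneg)
  have sq: "(?n powr q)\<^sup>2 = ?n powr (2 * q)" by (simp add: power2_eq_square flip: powr_add)
  have S0: "0 \<le> real d ^ p * (\<Sum>i<d. \<bar>y i\<bar> ^ p)" by (intro mult_nonneg_nonneg sum_nonneg) auto
  show ?thesis
  proof (cases "?n \<le> 1")
    case True
    then have "?n powr (2 * q) \<le> 1" using n0 q by (intro powr_le1) auto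
    then show ?thesis using S0 unfolding sq by linarith
  next
    case False
    have "Max ((\<lambda>i. \<bar>y i\<bar>) ` {..<d}) \<in> (\<lambda>i. \<bar>y i\<bar>) ` {..<d}" using d by (intro Max_in) (auto simp: lessThan_empty_iff)
    then obtain j where j: "j < d" "Max ((\<lambda>i. \<bar>y i\<bar>) ` {..<d}) = \<bar>y j\<bar>" by auto
    have "?n \<le> (\<Sum>i<d. \<bar>y i\<bar>)"
      using L2_set_le_sum_abs[of y "{..<d}"] by (simp add: l2norm_def L2_set_def)
    also have "\<dots> \<le> (\<Sum>i<d. \<bar>y j\<bar>)"
      unfolding j(2)[symmetric] by (intro sum_mono Max_ge) auto
    finally have nj: "?n \<le> real d * \<bar>y j\<bar>" by simp
    have "?n powr (2 * q) \<le> ?n powr (real p)" using False q by (intro powr_mono) auto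
    also have "\<dots> = ?n ^ p" using False by (simp add: powr_realpow)
    also have "\<dots> \<le> (real d * \<bar>y j\<bar>) ^ p" using nj n0 by (intro power_mono)
    also have "\<dots> = real d ^ p * \<bar>y j\<bar> ^ p" by (simp add: power_mult_distrib)
    also have "\<dots> \<le> real d ^ p * (\<Sum>i<d. \<bar>y i\<bar> ^ p)"
      using j(1) by (intro mult_left_mono member_le_sum[of j _ "\<lambda>i. \<bar>y i\<bar> ^ p"]) auto
    finally show ?thesis unfolding sq by linarith
  qed
qed

lemma (in prob_space) polynomial_growth_second_moment:
  assumes d: "d \<ge> 1" and Y [measurable]: "Y \<in> measurable M (Rd d)" and \<phi> [measurable]: "\<phi> \<in> borel_measurable (Rd d)"
    and growth: "\<And>y. y \<in> ({..<d} \<rightarrow>\<^sub>E (UNIV :: real set)) \<Longrightarrow> \<bar>\<phi> y\<bar> \<le> c * (1 + l2norm d y powr q)"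
    and q: "0 \<le> q" "2 * q \<le> real p"
    and mom: "\<And>i. i < d \<Longrightarrow> integrable M (\<lambda>\<omega>. \<bar>Y \<omega> i\<bar> ^ p)" "\<And>i. i < d \<Longrightarrow> expectation (\<lambda>\<omega>. \<bar>Y \<omega> i\<bar> ^ p) \<le> A"
    and A: "A \<ge> 0"
  shows "integrable M (\<lambda>\<omega>. (\<phi> (Y \<omega>))\<^sup>2)"
    and "expectation (\<lambda>\<omega>. (\<phi> (Y \<omega>))\<^sup>2) \<le> 2 * c\<^sup>2 * (2 + A) * real d ^ (p + 1)"
proof -
  let ?b = "\<lambda>\<omega>. 2 * c\<^sup>2 * (2 + real d ^ p * (\<Sum>i<d. \<bar>Y \<omega> i\<bar> ^ p))"
  have bound: "(\<phi> (Y \<omega>))\<^sup>2 \<le> ?b \<omega>" if "\<omega> \<in> space M" for \<omega>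
  proof -
    have "Y \<omega> \<in> space (Rd d)" using that Y by (rule measurable_space[rotated])
    then have "\<bar>\<phi> (Y \<omega>)\<bar> \<le> c * (1 + l2norm d (Y \<omega>) powr q)"
      by (intro growth) (auto simp: Rd_def space_PiM)
    then have "\<bar>\<phi> (Y \<omega>)\<bar>\<^sup>2 \<le> (c * (1 + l2norm d (Y \<omega>) powr q))\<^sup>2" by (intro power_mono) auto
    also have "\<dots> \<le> c\<^sup>2 * (2 * (1 + (l2norm d (Y \<omega>) powr q)\<^sup>2))"
      unfolding power_mult_distrib using zero_le_power2[of "1 - l2norm d (Y \<omega>) powr q"]
      by (intro mult_left_mono) (auto simp: power2_eq_square algebra_simps)
    also have "\<dots> \<le> c\<^sup>2 * (2 * (1 + (1 + real d ^ p * (\<Sum>i<d. \<bar>Y \<omega> i\<bar> ^ p))))"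
      by (intro mult_left_mono add_left_mono l2norm_powr_sq_le d q) auto
    finally show ?thesis by (simp add: algebra_simps)
  qed
  have intb: "integrable M ?b"
    using mom by (intro integrable_mult_right Bochner_Integration.integrable_add Bochner_Integration.integrable_sum) auto
  show int: "integrable M (\<lambda>\<omega>. (\<phi> (Y \<omega>))\<^sup>2)"
    by (rule Bochner_Integration.integrable_bound[OF intb]) (auto intro!: AE_I2 order.trans[OF bound])
  have "expectation (\<lambda>\<omega>. (\<phi> (Y \<omega>))\<^sup>2) \<le> expectation ?b"
    by (rule integral_mono[OF int intb bound])
  also have "\<dots> = 2 * c\<^sup>2 * (2 + real d ^ p * (\<Sum>i<d. expectation (\<lambda>\<omega>. \<bar>Y \<omega> i\<bar> ^ p)))"
    using mom by (subst Bochner_Integration.integral_mult_right_zero, subst Bochner_Integration.integral_add)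
      (auto simp: prob_space intro!: Bochner_Integration.integrable_sum Bochner_Integration.integral_sum)
  \<comment> \<open>The \<open>d\<close> coordinate moments contribute the extra factor
    \<open>d\<close>; since \<open>d \<ge> 1\<close>, the constant 2 is absorbed into the same
    power.\<close>
  also have "\<dots> \<le> 2 * c\<^sup>2 * (2 * real d ^ (p + 1) + real d ^ p * (\<Sum>i<d. A))"
    using mom one_le_power[of "real d" "p + 1"] d by (intro mult_left_mono add_mono sum_mono) auto
  also have "\<dots> = 2 * c\<^sup>2 * (2 + A) * real d ^ (p + 1)" by (simp add: algebra_simps)
  finally show "expectation (\<lambda>\<omega>. (\<phi> (Y \<omega>))\<^sup>2) \<le> 2 * c\<^sup>2 * (2 + A) * real d ^ (p + 1)" .
qed

section \<open>Empirical risk minimization\<close>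

lemma abs_integral_diff_le:
  fixes f g t :: "'a \<Rightarrow> real"
  assumes "integrable M f" "integrable M g" "integrable M t" "AE x in M. \<bar>f x - g x\<bar> \<le> t x"
  shows "\<bar>integral\<^sup>L M f - integral\<^sup>L M g\<bar> \<le> integral\<^sup>L M t"
proof -
  have "\<bar>integral\<^sup>L M f - integral\<^sup>L M g\<bar> = \<bar>\<integral>x. f x - g x \<partial>M\<bar>" using assms by simp
  also have "\<dots> \<le> (\<integral>x. \<bar>f x - g x\<bar> \<partial>M)" by (rule integral_abs_bound)
  also have "\<dots> \<le> integral\<^sup>L M t" using assms by (intro integral_mono_AE) auto
  finally show ?thesis .
qed

lemma abs_sum_diff_div_le:
  fixes f g t :: "nat \<Rightarrow> real"
  assumes "\<And>i. i < m \<Longrightarrow> \<bar>f i - g i\<bar> \<le> t i"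
  shows "\<bar>(\<Sum>i<m. f i) / m - (\<Sum>i<m. g i) / m\<bar> \<le> (\<Sum>i<m. t i) / m"
proof -
  have "\<bar>(\<Sum>i<m. f i) / m - (\<Sum>i<m. g i) / m\<bar> = \<bar>\<Sum>i<m. f i - g i\<bar> / m"
    by (simp add: sum_subtractf diff_divide_distrib[symmetric])
  also have "\<bar>\<Sum>i<m. f i - g i\<bar> \<le> (\<Sum>i<m. t i)"
    using assms by (intro order.trans[OF sum_abs] sum_mono) auto
  finally show ?thesis by (simp add: divide_right_mono)
qed

text \<open>The difference factors as \<open>(a - b) * (a + b - 2 * y)\<close>. It serves twice:
  with \<open>K\<close> a truncation level, and with \<open>K = \<bar>y\<bar>\<close> for the
  Lipschitz bound on the risk.\<close>

lemma truncated_product_diff_le: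
  fixes a b y :: real
  assumes "\<bar>a\<bar> \<le> D" "\<bar>b\<bar> \<le> D" "\<bar>y\<bar> \<le> K" "\<bar>a - b\<bar> \<le> \<eta>"
  shows "\<bar>(a\<^sup>2 - 2 * a * y) - (b\<^sup>2 - 2 * b * y)\<bar> \<le> \<eta> * (2 * D + 2 * K)"
proof -
  have "(a\<^sup>2 - 2 * a * y) - (b\<^sup>2 - 2 * b * y) = (a - b) * (a + b - 2 * y)"
    by (simp add: power2_eq_square algebra_simps)
  also have "\<bar>\<dots>\<bar> \<le> \<eta> * (2 * D + 2 * K)"
    unfolding abs_mult using assms by (intro mult_mono) auto
  finally show ?thesis .
qed

lemma space_sup_borel: "space (sup_borel u v d H) = H"
  unfolding sup_borel_def by (rule space_measure_of) auto

context prob_space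
begin

text \<open>If the reduced empirical and expected losses differ by at most
  \<open>\<epsilon> / 2\<close> simultaneously for all \<open>f\<close>, the empirical ordering of
  \<open>f\<close> and \<open>f0\<close> carries over to the risks up to \<open>\<epsilon>\<close>.
  The good event is chosen before \<open>f\<close> and \<open>f0\<close>, so it can be used for a
  minimizer depending on the outcome without any measurability of that minimizer.\<close>

lemma erm_excess_risk:
  fixes X Y :: "'a \<Rightarrow> nat \<Rightarrow> real" and S T :: "(nat \<Rightarrow> real) measure"
  assumes X [measurable]: "X \<in> measurable M S" and Y [measurable]: "Y \<in> measurable M T"
    and indep: "indep_vars (\<lambda>_. S \<Otimes>\<^sub>M T) (\<lambda>i \<omega>. (xs i \<omega>, ys i \<omega>)) UNIV"
    and distr: "\<And>i. distr M (S \<Otimes>\<^sub>M T) (\<lambda>\<omega>. (xs i \<omega>, ys i \<omega>)) = distr M (S \<Otimes>\<^sub>M T) (\<lambda>\<omega>. (X \<omega>, Y \<omega>))"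
    and \<phi> [measurable]: "\<phi> \<in> borel_measurable T"
    and C: "C \<in> sets S" "AE \<omega> in M. X \<omega> \<in> C"
    and H_meas: "\<And>f. f \<in> H \<Longrightarrow> f \<in> borel_measurable S"
    and H_bound: "\<And>f x. f \<in> H \<Longrightarrow> x \<in> C \<Longrightarrow> \<bar>f x\<bar> \<le> D" and D: "D > 0"
    and F: "finite F" "F \<subseteq> H" "\<And>f. f \<in> H \<Longrightarrow> \<exists>g\<in>F. \<forall>x\<in>C. \<bar>f x - g x\<bar> \<le> \<eta>"
    and sq: "integrable M (\<lambda>\<omega>. (\<phi> (Y \<omega>))\<^sup>2)" "expectation (\<lambda>\<omega>. (\<phi> (Y \<omega>))\<^sup>2) \<le> V"
    and K: "K > 0" "2 * D * V / K \<le> \<epsilon> * \<rho> / 32" and \<eta>: "\<eta> * (2 * D + 2 * K) \<le> \<epsilon> / 8"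
    and m: "m > 0" and \<epsilon>: "\<epsilon> > 0" and \<rho>: "0 < \<rho>" "\<rho> < 1"
    and card: "card F * (2 * exp (- (m * \<epsilon>\<^sup>2 / (128 * (D\<^sup>2 + 2 * D * K)\<^sup>2)))) \<le> \<rho> / 2"
  shows "\<exists>E\<in>events. prob E \<ge> 1 - \<rho> \<and> (\<forall>\<omega>\<in>E. \<forall>f\<in>H. \<forall>f0\<in>H.
           emp_risk m xs ys \<phi> f \<omega> \<le> emp_risk m xs ys \<phi> f0 \<omega> \<longrightarrow>
           risk M X Y \<phi> f - risk M X Y \<phi> f0 \<le> \<epsilon>)"
proof -
  let ?Z = "\<lambda>\<omega>. (X \<omega>, Y \<omega>)" and ?z = "\<lambda>i \<omega>. (xs i \<omega>, ys i \<omega>)"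
  \<comment> \<open>Values beyond the level are set to 0, so \<open>\<phi> - \<psi>\<close> is
    \<open>\<phi>\<close> there and is dominated by \<open>\<phi>^2 / K\<close>.\<close>
  define \<psi> where "\<psi> y = (if \<bar>\<phi> y\<bar> \<le> K then \<phi> y else 0)" for y
  \<comment> \<open>This bounds the truncation error in the loss for all \<open>f\<close> in
    \<open>H\<close> at once, so the tail needs no union bound.\<close>
  define \<tau> where "\<tau> y = 2 * D * \<bar>\<phi> y - \<psi> y\<bar>" for y
  define g where "g f z = (f (fst z))\<^sup>2 - 2 * f (fst z) * \<psi> (snd z)" for f :: "(nat \<Rightarrow> real) \<Rightarrow> real" and z
  define q where "q f z = (f (fst z))\<^sup>2 - 2 * f (fst z) * \<phi> (snd z)" for f :: "(nat \<Rightarrow> real) \<Rightarrow> real" and z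
  have [measurable]: "\<psi> \<in> borel_measurable T" unfolding \<psi>_def by measurable
  have [measurable]: "\<tau> \<in> borel_measurable T" unfolding \<tau>_def by measurable
  have g_meas: "g f \<in> borel_measurable (S \<Otimes>\<^sub>M T)" if "f \<in> H" for f
  proof -
    have [measurable]: "f \<in> borel_measurable S" by (rule H_meas[OF that])
    show ?thesis unfolding g_def by measurable
  qed
  have z_meas [measurable]: "?z i \<in> measurable M (S \<Otimes>\<^sub>M T)" for i
    using indep unfolding indep_vars_def2 by auto
  have xs_meas [measurable]: "xs i \<in> measurable M S" for i
    using measurable_compose[OF z_meas measurable_fst, of i] by simp
  have ys_meas [measurable]: "ys i \<in> measurable M T" for i
    using measurable_compose[OF z_meas measurable_snd, of i] by simp
  have \<psi>_bound: "\<bar>\<psi> y\<bar> \<le> K" for y using K by (auto simp: \<psi>_def)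
  have \<tau>_nonneg: "\<tau> y \<ge> 0" for y using D by (auto simp: \<tau>_def)
  have \<tau>_le: "\<tau> y \<le> 2 * D * ((\<phi> y)\<^sup>2 / K)" for y
  proof -
    have "\<bar>\<phi> y - \<psi> y\<bar> \<le> (\<phi> y)\<^sup>2 / K"
    proof (cases "\<bar>\<phi> y\<bar> \<le> K")
      case False
      then have "K * \<bar>\<phi> y\<bar> \<le> \<bar>\<phi> y\<bar> * \<bar>\<phi> y\<bar>" by (intro mult_right_mono) auto
      then show ?thesis using False K by (simp add: \<psi>_def field_simps power2_eq_square)
    qed (use K in \<open>simp add: \<psi>_def\<close>)
    then show ?thesis unfolding \<tau>_def using D by (intro mult_left_mono) auto
  qed
  have \<tau>_int: "integrable M (\<lambda>\<omega>. \<tau> (Y \<omega>))"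
  proof (rule Bochner_Integration.integrable_bound)
    show "integrable M (\<lambda>\<omega>. 2 * D * ((\<phi> (Y \<omega>))\<^sup>2 / K))" using sq by auto
    show "AE \<omega> in M. norm (\<tau> (Y \<omega>)) \<le> norm (2 * D * ((\<phi> (Y \<omega>))\<^sup>2 / K))"
      using \<tau>_nonneg by (intro AE_I2) (simp only: real_norm_def abs_of_nonneg order.trans[OF \<tau>_le abs_ge_self])
  qed measurable
  have "expectation (\<lambda>\<omega>. \<tau> (Y \<omega>)) \<le> expectation (\<lambda>\<omega>. 2 * D * ((\<phi> (Y \<omega>))\<^sup>2 / K))"
    using sq \<tau>_int \<tau>_le by (intro integral_mono) auto
  also have "\<dots> = 2 * D * expectation (\<lambda>\<omega>. (\<phi> (Y \<omega>))\<^sup>2) / K" by simp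
  also have "\<dots> \<le> 2 * D * V / K" using sq D K by (intro divide_right_mono mult_left_mono) auto
  finally have \<tau>_exp: "expectation (\<lambda>\<omega>. \<tau> (Y \<omega>)) \<le> \<epsilon> * \<rho> / 32" using K by linarith
  have transfer: "integrable M (\<lambda>\<omega>. k (?z i \<omega>)) \<longleftrightarrow> integrable M (\<lambda>\<omega>. k (?Z \<omega>))"
    "expectation (\<lambda>\<omega>. k (?z i \<omega>)) = expectation (\<lambda>\<omega>. k (?Z \<omega>))"
    if [measurable]: "k \<in> borel_measurable (S \<Otimes>\<^sub>M T)" for k :: "_ \<Rightarrow> real" and i
  proof -
    show "integrable M (\<lambda>\<omega>. k (?z i \<omega>)) \<longleftrightarrow> integrable M (\<lambda>\<omega>. k (?Z \<omega>))"
      using integrable_distr_eq[OF z_meas that, of i] integrable_distr_eq[of ?Z M "S \<Otimes>\<^sub>M T" k] distr[of i] by simp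
    show "expectation (\<lambda>\<omega>. k (?z i \<omega>)) = expectation (\<lambda>\<omega>. k (?Z \<omega>))"
      using integral_distr[OF z_meas that, of i] integral_distr[of ?Z M "S \<Otimes>\<^sub>M T" k] distr[of i] by simp
  qed
  have [measurable]: "Measurable.pred S (\<lambda>x. x \<in> C)" using C(1) by (intro pred_sets2[OF C(1)]) auto
  \<comment> \<open>Lying in \<open>C\<close> concerns the first component only and transfers
    through the common joint law.\<close>
  have xs_C: "AE \<omega> in M. xs i \<omega> \<in> C" for i
  proof -
    have "AE z in distr M (S \<Otimes>\<^sub>M T) ?Z. fst z \<in> C"
      using C(2) by (subst AE_distr_iff) auto
    then have "AE z in distr M (S \<Otimes>\<^sub>M T) (?z i). fst z \<in> C" by (subst distr)
    then show ?thesis by (subst (asm) AE_distr_iff) auto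
  qed

  \<comment> \<open>On \<open>C\<close> every \<open>g f\<close> takes values in
    \<open>{- B..B}\<close>, the range for Hoeffding's inequality.\<close>
  define B where "B = D\<^sup>2 + 2 * D * K"
  have B: "B > 0" using D K by (auto simp: B_def intro: add_pos_pos)
  define Bf where "Bf f = {\<omega> \<in> space M. \<bar>(\<Sum>i<m. g f (?z i \<omega>)) / m - expectation (\<lambda>\<omega>. g f (?Z \<omega>))\<bar> \<ge> \<epsilon> / 8}" for f
  have Bf_sets: "Bf f \<in> events" if "f \<in> H" for f
  proof -
    have [measurable]: "g f \<in> borel_measurable (S \<Otimes>\<^sub>M T)" by (rule g_meas[OF that])
    show ?thesis unfolding Bf_def by measurable
  qed
  have Bf_prob: "prob (Bf f) \<le> 2 * exp (- (m * \<epsilon>\<^sup>2 / (128 * B\<^sup>2)))" if f: "f \<in> H" for f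
  proof -
    have [measurable]: "g f \<in> borel_measurable (S \<Otimes>\<^sub>M T)" by (rule g_meas[OF f])
    interpret Hoeffding_ineq_iid M "{..<m}" "\<lambda>i \<omega>. g f (?z i \<omega>)" "\<lambda>\<omega>. g f (?Z \<omega>)" "- B" B
      "expectation (\<lambda>\<omega>. g f (?Z \<omega>))"
    proof unfold_locales
      show "indep_vars (\<lambda>_. borel) (\<lambda>i \<omega>. g f (?z i \<omega>)) {..<m}"
        by (rule indep_vars_compose2[OF indep_vars_subset[OF indep]]) auto
      show "distr M borel (\<lambda>\<omega>. g f (?z i \<omega>)) = distr M borel (\<lambda>\<omega>. g f (?Z \<omega>))" for i
        using distr_distr[of "g f" "S \<Otimes>\<^sub>M T" borel "?z i" M] distr_distr[of "g f" "S \<Otimes>\<^sub>M T" borel ?Z M] distr[of i]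
        by (simp add: comp_def)
      show "AE \<omega> in M. g f (?Z \<omega>) \<in> {- B..B}"
        using C(2)
      proof eventually_elim
        case (elim \<omega>)
        have "\<bar>(f (X \<omega>))\<^sup>2 - 2 * f (X \<omega>) * \<psi> (Y \<omega>)\<bar> \<le> \<bar>f (X \<omega>)\<bar>\<^sup>2 + 2 * \<bar>f (X \<omega>)\<bar> * \<bar>\<psi> (Y \<omega>)\<bar>"
          by (rule order.trans[OF abs_triangle_ineq4]) (simp add: abs_mult)
        also have "\<dots> \<le> D\<^sup>2 + 2 * D * K"
          using H_bound[OF f elim] \<psi>_bound D by (intro add_mono mult_mono power_mono) auto
        finally show ?case by (auto simp: g_def B_def abs_le_iff)
      qed
    qed auto
    have "prob (Bf f) \<le> 2 * exp (- 2 * real m * (\<epsilon> / 8)\<^sup>2 / (B - (- B))\<^sup>2)"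
      unfolding Bf_def using Hoeffding_ineq_abs_ge'[of "\<epsilon> / 8"] \<epsilon> B m by (simp add: lessThan_empty_iff)
    \<comment> \<open>The range has length \<open>2 * B\<close> and the deviation is
      \<open>\<epsilon> / 8\<close>, whence 128 = 64 * 4 / 2.\<close>
    also have "- 2 * real m * (\<epsilon> / 8)\<^sup>2 / (B - (- B))\<^sup>2 = - (m * \<epsilon>\<^sup>2 / (128 * B\<^sup>2))"
      using B by (simp add: field_simps power2_eq_square)
    finally show ?thesis .
  qed
  \<comment> \<open>Markov's inequality gives probability at most
    \<open>(\<epsilon> * \<rho> / 32) / (\<epsilon> / 16) = \<rho> / 2\<close>.\<close>
  define B0 where "B0 = {\<omega> \<in> space M. (\<Sum>i<m. \<tau> (ys i \<omega>)) / m \<ge> \<epsilon> / 16}"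
  have B0_sets: "B0 \<in> events" unfolding B0_def by measurable
  have tau_i: "integrable M (\<lambda>\<omega>. \<tau> (ys i \<omega>))" "expectation (\<lambda>\<omega>. \<tau> (ys i \<omega>)) = expectation (\<lambda>\<omega>. \<tau> (Y \<omega>))" for i
    using transfer[of "\<lambda>z. \<tau> (snd z)" i] \<tau>_int by auto
  have "prob B0 \<le> expectation (\<lambda>\<omega>. (\<Sum>i<m. \<tau> (ys i \<omega>)) / m) / (\<epsilon> / 16)"
    unfolding B0_def using tau_i \<epsilon> \<tau>_nonneg
    by (intro integral_Markov_inequality_measure[where A = "space M"]) (auto intro!: divide_nonneg_nonneg sum_nonneg)
  also have "\<dots> = expectation (\<lambda>\<omega>. \<tau> (Y \<omega>)) / (\<epsilon> / 16)" using tau_i m by simp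
  also have "\<dots> \<le> \<rho> / 2" using \<tau>_exp \<epsilon> by (simp add: field_simps)
  finally have B0_prob: "prob B0 \<le> \<rho> / 2" .
  \<comment> \<open>The bounds on \<open>H\<close> and the net property are available only on
    \<open>C\<close>, so samples outside it are discarded as a null event.\<close>
  define N where "N = {\<omega> \<in> space M. \<exists>i<m. xs i \<omega> \<notin> C}"
  have N_sets: "N \<in> events" unfolding N_def by measurable
  have "AE \<omega> in M. \<omega> \<notin> N" using xs_C by (auto simp: N_def AE_all_countable)
  then have N_prob: "prob N = 0" using N_sets by (simp add: AE_iff_measurable[OF N_sets] measure_def N_def prob_eq_0)
  define E where "E = space M - ((\<Union>f\<in>F. Bf f) \<union> B0 \<union> N)"
  have UF: "(\<Union>f\<in>F. Bf f) \<in> events" using F Bf_sets by (intro sets.finite_UN) auto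
  have E_sets: "E \<in> events" unfolding E_def using UF B0_sets N_sets by auto
  have "prob (\<Union>f\<in>F. Bf f) \<le> (\<Sum>f\<in>F. prob (Bf f))"
    using F Bf_sets by (intro finite_measure_subadditive_finite) auto
  also have "\<dots> \<le> (\<Sum>f\<in>F. 2 * exp (- (m * \<epsilon>\<^sup>2 / (128 * B\<^sup>2))))"
    using F Bf_prob by (intro sum_mono) auto
  also have "\<dots> \<le> \<rho> / 2" using card by (simp add: B_def)
  finally have UF_prob: "prob (\<Union>f\<in>F. Bf f) \<le> \<rho> / 2" .
  have "prob ((\<Union>f\<in>F. Bf f) \<union> B0 \<union> N) \<le> prob (\<Union>f\<in>F. Bf f) + prob B0 + prob N"
    using UF B0_sets N_sets
    by (intro order.trans[OF measure_Un_le] add_mono order.trans[OF measure_Un_le]) auto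
  then have E_prob: "prob E \<ge> 1 - \<rho>"
    unfolding E_def using UF B0_sets N_sets B0_prob UF_prob N_prob by (subst prob_compl) auto

  have \<phi>_int: "integrable M (\<lambda>\<omega>. \<phi> (Y \<omega>))"
    by (rule square_integrable_imp_integrable[OF _ sq(1)]) measurable
  have f_int: "integrable M (\<lambda>\<omega>. (f (X \<omega>))\<^sup>2)" "integrable M (\<lambda>\<omega>. f (X \<omega>) * \<phi> (Y \<omega>))" 
      "integrable M (\<lambda>\<omega>. f (X \<omega>) * \<psi> (Y \<omega>))" if f: "f \<in> H" for f
  proof -
    have [measurable]: "f \<in> borel_measurable S" by (rule H_meas[OF f])
    have bd: "AE \<omega> in M. \<bar>f (X \<omega>)\<bar> \<le> D" using C(2) H_bound[OF f] by auto
    show "integrable M (\<lambda>\<omega>. (f (X \<omega>))\<^sup>2)"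
    proof (rule integrable_const_bound)
      show "AE \<omega> in M. norm ((f (X \<omega>))\<^sup>2) \<le> D\<^sup>2"
        using bd by eventually_elim (simp add: abs_le_square_iff[symmetric])
    qed measurable
    show "integrable M (\<lambda>\<omega>. f (X \<omega>) * \<phi> (Y \<omega>))"
    proof (rule Bochner_Integration.integrable_bound)
      show "integrable M (\<lambda>\<omega>. D * \<phi> (Y \<omega>))" using \<phi>_int by simp
      show "AE \<omega> in M. norm (f (X \<omega>) * \<phi> (Y \<omega>)) \<le> norm (D * \<phi> (Y \<omega>))"
        using bd by eventually_elim (auto simp: abs_mult intro!: mult_right_mono)
    qed measurable
    show "integrable M (\<lambda>\<omega>. f (X \<omega>) * \<psi> (Y \<omega>))"
    proof (rule Bochner_Integration.integrable_bound)
      show "integrable M (\<lambda>\<omega>. D * K)" by simp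
      show "AE \<omega> in M. norm (f (X \<omega>) * \<psi> (Y \<omega>)) \<le> norm (D * K)"
        using bd by eventually_elim (use \<psi>_bound K D in \<open>auto simp: abs_mult intro!: mult_mono\<close>)
    qed measurable
  qed
  have g_int: "integrable M (\<lambda>\<omega>. g f (?Z \<omega>))" and q_int: "integrable M (\<lambda>\<omega>. q f (?Z \<omega>))" if "f \<in> H" for f
    using f_int[OF that] by (auto simp: g_def q_def mult.assoc)
  have gq: "\<bar>q f z - g f z\<bar> \<le> \<tau> (snd z)" if "f \<in> H" "fst z \<in> C" for f z
  proof -
    have "q f z - g f z = 2 * f (fst z) * (\<psi> (snd z) - \<phi> (snd z))" by (simp add: g_def q_def algebra_simps)
    also have "\<bar>\<dots>\<bar> \<le> \<tau> (snd z)" 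
      unfolding \<tau>_def abs_mult using H_bound[OF that] by (intro mult_mono) auto
    finally show ?thesis .
  qed
  \<comment> \<open>The chain is empirical \<open>q f\<close>, \<open>g f\<close>,
    \<open>g f'\<close>, then expected \<open>g f'\<close>, \<open>g f\<close>, \<open>q f\<close>.
    The errors 1/16, 1/8, 1/8, 1/8 and 1/32 add up to 15/32 of \<open>\<epsilon>\<close>.\<close>
  have dev: "\<bar>(\<Sum>i<m. q f (?z i \<omega>)) / m - expectation (\<lambda>\<omega>. q f (?Z \<omega>))\<bar> \<le> \<epsilon> / 2"
    if f: "f \<in> H" and \<omega>: "\<omega> \<in> E" for f \<omega>
  proof -
    obtain f' where f': "f' \<in> F" and close: "\<And>x. x \<in> C \<Longrightarrow> \<bar>f x - f' x\<bar> \<le> \<eta>" using F(3)[OF f] by blast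
    have f'H: "f' \<in> H" using f' F by auto
    have \<omega>C: "xs i \<omega> \<in> C" if "i < m" for i using \<omega> that by (auto simp: E_def N_def)
    have gg: "\<bar>g f z - g f' z\<bar> \<le> \<epsilon> / 8" if "fst z \<in> C" for z
      unfolding g_def using H_bound[OF f that] H_bound[OF f'H that] close[OF that] \<psi>_bound
      by (intro order.trans[OF truncated_product_diff_le \<eta>])
    have "\<bar>(\<Sum>i<m. q f (?z i \<omega>)) / m - (\<Sum>i<m. g f (?z i \<omega>)) / m\<bar> \<le> (\<Sum>i<m. \<tau> (ys i \<omega>)) / m"
      using gq[OF f] \<omega>C by (intro abs_sum_diff_div_le) (metis fst_conv snd_conv)
    also have "\<dots> < \<epsilon> / 16" using \<omega> by (auto simp: E_def B0_def)
    finally have 1: "\<bar>(\<Sum>i<m. q f (?z i \<omega>)) / m - (\<Sum>i<m. g f (?z i \<omega>)) / m\<bar> < \<epsilon> / 16" .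
    have "\<bar>(\<Sum>i<m. g f (?z i \<omega>)) / m - (\<Sum>i<m. g f' (?z i \<omega>)) / m\<bar> \<le> (\<Sum>i<m. \<epsilon> / 8) / m"
      using gg \<omega>C by (intro abs_sum_diff_div_le) auto
    then have 2: "\<bar>(\<Sum>i<m. g f (?z i \<omega>)) / m - (\<Sum>i<m. g f' (?z i \<omega>)) / m\<bar> \<le> \<epsilon> / 8" using m by simp
    have 3: "\<bar>(\<Sum>i<m. g f' (?z i \<omega>)) / m - expectation (\<lambda>\<omega>. g f' (?Z \<omega>))\<bar> < \<epsilon> / 8"
      using \<omega> f' by (auto simp: E_def Bf_def)
    have "\<bar>expectation (\<lambda>\<omega>. g f (?Z \<omega>)) - expectation (\<lambda>\<omega>. g f' (?Z \<omega>))\<bar> \<le> expectation (\<lambda>\<omega>. \<epsilon> / 8)"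
      using C(2) gg by (intro abs_integral_diff_le g_int f f'H) auto
    then have 4: "\<bar>expectation (\<lambda>\<omega>. g f (?Z \<omega>)) - expectation (\<lambda>\<omega>. g f' (?Z \<omega>))\<bar> \<le> \<epsilon> / 8" by (simp add: prob_space)
    have "\<bar>expectation (\<lambda>\<omega>. q f (?Z \<omega>)) - expectation (\<lambda>\<omega>. g f (?Z \<omega>))\<bar> \<le> expectation (\<lambda>\<omega>. \<tau> (Y \<omega>))"
      using C(2) gq[OF f] by (intro abs_integral_diff_le g_int q_int f \<tau>_int) auto
    also have "\<dots> \<le> \<epsilon> / 32" using \<tau>_exp mult_left_mono[of \<rho> 1 \<epsilon>] \<epsilon> \<rho> by linarith
    finally have 5: "\<bar>expectation (\<lambda>\<omega>. q f (?Z \<omega>)) - expectation (\<lambda>\<omega>. g f (?Z \<omega>))\<bar> \<le> \<epsilon> / 32" .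
    show ?thesis using 1 2 3 4 5 \<epsilon> by linarith
  qed
  have risk_eq: "risk M X Y \<phi> f = expectation (\<lambda>\<omega>. q f (?Z \<omega>)) + expectation (\<lambda>\<omega>. (\<phi> (Y \<omega>))\<^sup>2)" if "f \<in> H" for f
  proof -
    have "risk M X Y \<phi> f = expectation (\<lambda>\<omega>. q f (?Z \<omega>) + (\<phi> (Y \<omega>))\<^sup>2)"
      unfolding risk_def q_def by (simp add: power2_diff algebra_simps)
    also have "\<dots> = expectation (\<lambda>\<omega>. q f (?Z \<omega>)) + expectation (\<lambda>\<omega>. (\<phi> (Y \<omega>))\<^sup>2)"
      by (rule Bochner_Integration.integral_add[OF q_int[OF that] sq(1)])
    finally show ?thesis .
  qed
  have emp_eq: "emp_risk m xs ys \<phi> f \<omega> = (\<Sum>i<m. q f (?z i \<omega>)) / m + (\<Sum>i<m. (\<phi> (ys i \<omega>))\<^sup>2) / m" for f \<omega>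
    unfolding emp_risk_def q_def add_divide_distrib[symmetric] sum.distrib[symmetric]
    by (simp add: power2_diff algebra_simps)
  show ?thesis
  proof (intro bexI[of _ E] conjI ballI impI E_prob E_sets)
    fix \<omega> f f0 assume *: "\<omega> \<in> E" "f \<in> H" "f0 \<in> H" "emp_risk m xs ys \<phi> f \<omega> \<le> emp_risk m xs ys \<phi> f0 \<omega>"
    then show "risk M X Y \<phi> f - risk M X Y \<phi> f0 \<le> \<epsilon>"
      using dev[of f \<omega>] dev[of f0 \<omega>] unfolding emp_eq risk_eq[OF *(2)] risk_eq[OF *(3)] abs_le_iff by linarith
  qed
qed

text \<open>Continuity of the risk in the sup distance is what will make the excess risk of a
  measurable minimizer a random variable; the constant may depend on \<open>\<phi>\<close> and need
  not be quantitative.\<close>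

lemma risk_lipschitz:
  fixes X Y :: "'a \<Rightarrow> nat \<Rightarrow> real" and S T :: "(nat \<Rightarrow> real) measure"
  assumes X [measurable]: "X \<in> measurable M S" and Y [measurable]: "Y \<in> measurable M T"
    and \<phi> [measurable]: "\<phi> \<in> borel_measurable T"
    and C: "AE \<omega> in M. X \<omega> \<in> C"
    and f [measurable]: "f \<in> borel_measurable S" and f_bound: "\<And>x. x \<in> C \<Longrightarrow> \<bar>f x\<bar> \<le> D"
    and g [measurable]: "g \<in> borel_measurable S" and g_bound: "\<And>x. x \<in> C \<Longrightarrow> \<bar>g x\<bar> \<le> D"
    and fg: "\<And>x. x \<in> C \<Longrightarrow> \<bar>f x - g x\<bar> \<le> \<eta>"
    and sq: "integrable M (\<lambda>\<omega>. (\<phi> (Y \<omega>))\<^sup>2)"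
  shows "\<bar>risk M X Y \<phi> f - risk M X Y \<phi> g\<bar> \<le> \<eta> * (2 * D + 2 * expectation (\<lambda>\<omega>. \<bar>\<phi> (Y \<omega>)\<bar>))"
proof -
  have \<phi>_int: "integrable M (\<lambda>\<omega>. \<phi> (Y \<omega>))"
    by (rule square_integrable_imp_integrable[OF _ sq(1)]) measurable
  have int: "integrable M (\<lambda>\<omega>. (h (X \<omega>) - \<phi> (Y \<omega>))\<^sup>2)"
    if [measurable]: "h \<in> borel_measurable S" and h_bound: "\<And>x. x \<in> C \<Longrightarrow> \<bar>h x\<bar> \<le> D" for h
  proof (rule Bochner_Integration.integrable_bound)
    show "integrable M (\<lambda>\<omega>. 2 * D\<^sup>2 + 2 * (\<phi> (Y \<omega>))\<^sup>2)" using sq by simp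
    show "AE \<omega> in M. norm ((h (X \<omega>) - \<phi> (Y \<omega>))\<^sup>2) \<le> norm (2 * D\<^sup>2 + 2 * (\<phi> (Y \<omega>))\<^sup>2)"
      using C
    proof eventually_elim
      case (elim \<omega>)
      have "(h (X \<omega>))\<^sup>2 \<le> D\<^sup>2" using h_bound[OF elim] by (simp add: abs_le_square_iff[symmetric])
      moreover have "(h (X \<omega>) - \<phi> (Y \<omega>))\<^sup>2 \<le> 2 * (h (X \<omega>))\<^sup>2 + 2 * (\<phi> (Y \<omega>))\<^sup>2"
        using zero_le_power2[of "h (X \<omega>) + \<phi> (Y \<omega>)"] by (simp add: power2_diff power2_sum)
      ultimately show ?case by simp
    qed
  qed measurable
  have "\<bar>risk M X Y \<phi> f - risk M X Y \<phi> g\<bar> \<le> expectation (\<lambda>\<omega>. \<eta> * (2 * D + 2 * \<bar>\<phi> (Y \<omega>)\<bar>))"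
    unfolding risk_def
  proof (rule abs_integral_diff_le)
    show "AE \<omega> in M. \<bar>(f (X \<omega>) - \<phi> (Y \<omega>))\<^sup>2 - (g (X \<omega>) - \<phi> (Y \<omega>))\<^sup>2\<bar> \<le> \<eta> * (2 * D + 2 * \<bar>\<phi> (Y \<omega>)\<bar>)"
      using C
    proof eventually_elim
      case (elim \<omega>)
      show ?case
        \<comment> \<open>The bound for \<open>y\<close> is taken pointwise as
          \<open>\<bar>\<phi> (Y \<omega>)\<bar>\<close>; the squares of \<open>\<phi>\<close>
          cancel.\<close>
        using truncated_product_diff_le[OF f_bound[OF elim] g_bound[OF elim] order.refl fg[OF elim], of "\<phi> (Y \<omega>)"]
        by (simp add: power2_diff)
    qed
  qed (use int f_bound g_bound \<phi>_int in auto)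
  then show ?thesis using \<phi>_int by (simp add: prob_space)
qed

text \<open>A superlevel set of a Lipschitz functional is open: around \<open>f\<close> the radius
  \<open>(\<Psi> f - c) / L\<close> works. It is therefore a generator of \<open>sup_borel\<close>,
  and its preimage is complementary to the set in question.\<close>

lemma sup_borel_sublevel_measurable:
  assumes fm: "fm \<in> measurable M (sup_borel u v d H)"
    and lip: "\<And>f g. f \<in> H \<Longrightarrow> g \<in> H \<Longrightarrow> \<bar>\<Psi> f - \<Psi> g\<bar> \<le> sup_dist u v d f g * L"
    and L: "L > 0"
  shows "{\<omega> \<in> space M. \<Psi> (fm \<omega>) \<le> c} \<in> events"
proof -
  let ?G = "{U. U \<subseteq> H \<and> (\<forall>f\<in>U. \<exists>r>0. {g\<in>H. sup_dist u v d f g < r} \<subseteq> U)}"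
  have G: "?G \<subseteq> Pow H" by auto
  have sets: "sets (sup_borel u v d H) = sigma_sets H ?G" unfolding sup_borel_def by (rule sets_measure_of[OF G])
  have "{f\<in>H. \<Psi> f > c} \<in> ?G"
  proof (intro CollectI conjI ballI)
    fix f assume f: "f \<in> {f\<in>H. \<Psi> f > c}"
    show "\<exists>r>0. {g\<in>H. sup_dist u v d f g < r} \<subseteq> {f\<in>H. \<Psi> f > c}"
    proof (intro exI[of _ "(\<Psi> f - c) / L"] conjI subsetI)
      show "0 < (\<Psi> f - c) / L" using f L by simp
      fix g assume g: "g \<in> {g\<in>H. sup_dist u v d f g < (\<Psi> f - c) / L}"
      then have "sup_dist u v d f g * L < \<Psi> f - c" using L by (simp add: pos_less_divide_eq)
      then show "g \<in> {f\<in>H. \<Psi> f > c}" using lip[of f g] f g by auto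
    qed
  qed auto
  then have "{f\<in>H. \<Psi> f > c} \<in> sets (sup_borel u v d H)" unfolding sets by (rule sigma_sets.Basic)
  then have "fm -` {f\<in>H. \<Psi> f > c} \<inter> space M \<in> events" by (rule measurable_sets[OF fm])
  then have "space M - (fm -` {f\<in>H. \<Psi> f > c} \<inter> space M) \<in> events" by auto
  also have "space M - (fm -` {f\<in>H. \<Psi> f > c} \<inter> space M) = {\<omega> \<in> space M. \<Psi> (fm \<omega>) \<le> c}"
    using measurable_space[OF fm] by (auto simp: space_sup_borel)
  finally show ?thesis .
qed

end

section \<open>Sample complexity\<close>

text \<open>The common bound \<open>D\<close> makes the real supremum one over a set bounded above,
  so that it is an upper bound.\<close>

lemma sup_dist_upper:
  assumes "\<And>x. x \<in> cube u v d \<Longrightarrow> \<bar>f x\<bar> \<le> D" "\<And>x. x \<in> cube u v d \<Longrightarrow> \<bar>g x\<bar> \<le> D" "x \<in> cube u v d"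
  shows "\<bar>f x - g x\<bar> \<le> sup_dist u v d f g"
  unfolding sup_dist_def
proof (rule cSUP_upper[OF assms(3)])
  show "bdd_above ((\<lambda>x. \<bar>f x - g x\<bar>) ` cube u v d)"
  proof (rule bdd_aboveI2)
    fix x assume "x \<in> cube u v d"
    then show "\<bar>f x - g x\<bar> \<le> D + D" using assms(1,2)[of x] by linarith
  qed
qed

lemma AE_uniform_cube:
  assumes X [measurable]: "X \<in> measurable M (Rd d)"
    and unif: "distr M (Rd d) X = uniform_measure (Rd d) (cube u v d)"
  shows "AE \<omega> in M. X \<omega> \<in> cube u v d"
proof -
  have [measurable]: "cube u v d \<in> sets (Rd d)" by (rule sets_cube)
  have "emeasure (distr M (Rd d) X) (space (Rd d) - cube u v d) = 0"
    unfolding unif by (subst emeasure_uniform_measure) (auto simp: Diff_disjoint Int_Diff)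
  then have "AE x in distr M (Rd d) X. x \<in> cube u v d"
    by (intro AE_I[where N = "space (Rd d) - cube u v d"]) auto
  then show ?thesis by (subst (asm) AE_distr_iff) auto
qed

section \<open>Exponential estimates behind the sample size\<close>

lemma le_exp: "(x::real) \<le> exp x"
  using exp_ge_add_one_self[of x] by linarith

text \<open>The choice of \<open>\<delta>\<close> turns \<open>2 * R / \<delta>\<close> into a
  product, each factor of which is at most an exponential by \<open>x \<le> exp x\<close>. The
  logarithm of the net size thus becomes polynomial in \<open>n\<close>, \<open>r\<close>,
  \<open>s\<close> and \<open>W\<close>.\<close>

lemma covering_number_le_exp:
  fixes R W r s Q \<delta> :: real
  assumes R: "R > 0" "R \<le> exp r" and W: "W > 0" and n: "n \<ge> 1" and r: "r \<ge> 0" and s: "s \<ge> 1"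
    and Q: "Q = (real n + 1) * exp r" and \<delta>: "\<delta> = 1 / (W * (real n * Q ^ n * s))"
  shows "(2 * R / \<delta> + 1) ^ n \<le> exp (real n * (2 + r + real n + real n * (real n + r) + s + W))"
proof -
  let ?E = "1 + r + real n + real n * (real n + r) + s + W"
  have Q0: "Q > 0" unfolding Q by (intro mult_pos_pos) auto
  have "Q \<le> exp (real n) * exp r" unfolding Q by (intro mult_right_mono) (auto simp: add.commute)
  then have "Q ^ n \<le> (exp (real n) * exp r) ^ n" using Q0 by (intro power_mono) auto
  also have "\<dots> = exp (real n * (real n + r))" by (simp only: exp_of_nat_mult exp_add)
  finally have Qn: "Q ^ n \<le> exp (real n * (real n + r))" .
  have two: "(2::real) \<le> exp 1" using exp_ge_add_one_self[of 1] by simp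
  have "2 * R / \<delta> = 2 * R * (W * (real n * Q ^ n * s))" by (simp add: \<delta>)
  also have "\<dots> \<le> exp 1 * exp r * (exp W * (exp (real n) * exp (real n * (real n + r)) * exp s))"
    using R two W Qn Q0 s by (intro mult_mono le_exp) auto
  also have "\<dots> = exp ?E" by (simp add: exp_add[symmetric] algebra_simps)
  finally have "2 * R / \<delta> + 1 \<le> exp ?E + 1" by simp
  \<comment> \<open>As \<open>?E \<ge> 0\<close>, the summand 1 costs a factor 2, hence one more
    unit in the exponent.\<close>
  also have "\<dots> \<le> exp ?E * 2"
    using r s W by (simp add: add_nonneg_nonneg)
  also have "\<dots> \<le> exp ?E * exp 1" using two by (intro mult_left_mono) auto
  also have "\<dots> = exp (2 + r + real n + real n * (real n + r) + s + W)" by (simp add: exp_add[symmetric] algebra_simps)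
  finally have "2 * R / \<delta> + 1 \<le> exp (2 + r + real n + real n * (real n + r) + s + W)" .
  moreover have "0 \<le> 2 * R / \<delta> + 1" using R W Q0 s n by (simp add: \<delta>)
  ultimately have "(2 * R / \<delta> + 1) ^ n \<le> exp (2 + r + real n + real n * (real n + r) + s + W) ^ n"
    by (intro power_mono) auto
  then show ?thesis by (simp only: exp_of_nat_mult)
qed

text \<open>The size of \<open>m\<close> makes the Hoeffding exponent at least
  \<open>\<Theta> + 4 / \<rho>\<close>; \<open>\<Theta>\<close> cancels the net size, and
  \<open>exp (4 / \<rho>) \<ge> 4 / \<rho>\<close> does the rest. Using \<open>4 / \<rho>\<close> in
  place of its logarithm keeps the requirement polynomial.\<close>

lemma union_bound_le:
  fixes B \<epsilon> \<rho> \<Theta> N m :: real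
  assumes N: "N \<le> exp \<Theta>" and B: "B > 0" and \<epsilon>: "\<epsilon> > 0" and \<rho>: "\<rho> > 0"
    and m: "m \<ge> 128 * B\<^sup>2 * (1 / \<epsilon>)\<^sup>2 * (\<Theta> + 4 * (1 / \<rho>))"
  shows "N * (2 * exp (- (m * \<epsilon>\<^sup>2 / (128 * B\<^sup>2)))) \<le> \<rho> / 2"
proof -
  have "\<Theta> + 4 / \<rho> = (128 * B\<^sup>2 * (1 / \<epsilon>)\<^sup>2 * (\<Theta> + 4 * (1 / \<rho>))) * \<epsilon>\<^sup>2 / (128 * B\<^sup>2)"
    using B \<epsilon> by (simp add: power_divide)
  also have "\<dots> \<le> m * \<epsilon>\<^sup>2 / (128 * B\<^sup>2)" using m by (intro divide_right_mono mult_right_mono) auto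
  finally have *: "- (m * \<epsilon>\<^sup>2 / (128 * B\<^sup>2)) \<le> - (\<Theta> + 4 / \<rho>)" by simp
  have "N * (2 * exp (- (m * \<epsilon>\<^sup>2 / (128 * B\<^sup>2)))) \<le> exp \<Theta> * (2 * exp (- (\<Theta> + 4 / \<rho>)))"
    using N * by (intro mult_mono) auto
  also have "\<dots> = 2 / exp (4 / \<rho>)" by (simp add: exp_minus exp_add exp_diff field_simps)
  also have "\<dots> \<le> 2 / (4 / \<rho>)" using \<rho> by (intro divide_left_mono le_exp) auto
  finally show ?thesis by simp
qed

theorem theorem3p9:
  fixes M :: "'a measure"
    and u v c1 c2 lam :: real
    and X Y :: "nat \<Rightarrow> 'a \<Rightarrow> (nat \<Rightarrow> real)"
    and xs ys :: "nat \<Rightarrow> nat \<Rightarrow> 'a \<Rightarrow> (nat \<Rightarrow> real)"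
    and \<phi> :: "nat \<Rightarrow> (nat \<Rightarrow> real) \<Rightarrow> real"
  assumes P: "prob_space M"
    and uv: "u < v"
    and X_meas: "\<And>d. d \<ge> 1 \<Longrightarrow> X d \<in> measurable M (Rd d)"
    and X_unif: "\<And>d. d \<ge> 1 \<Longrightarrow> distr M (Rd d) (X d) = uniform_measure (Rd d) (cube u v d)"
    and Y_meas: "\<And>d. d \<ge> 1 \<Longrightarrow> Y d \<in> measurable M (Rd d)"
    and iid_indep: "\<And>d. d \<ge> 1 \<Longrightarrow>
          prob_space.indep_vars M (\<lambda>_. Rd d \<Otimes>\<^sub>M Rd d) (\<lambda>i \<omega>. (xs d i \<omega>, ys d i \<omega>)) UNIV"
    and iid_distr: "\<And>d i. d \<ge> 1 \<Longrightarrow>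
          distr M (Rd d \<Otimes>\<^sub>M Rd d) (\<lambda>\<omega>. (xs d i \<omega>, ys d i \<omega>)) =
          distr M (Rd d \<Otimes>\<^sub>M Rd d) (\<lambda>\<omega>. (X d \<omega>, Y d \<omega>))"
    and phi_meas: "\<And>d. d \<ge> 1 \<Longrightarrow> \<phi> d \<in> borel_measurable (Rd d)"
    and c1: "c1 > 0"
    and cond_i: "\<And>d t i. d \<ge> 1 \<Longrightarrow> t \<ge> 1 \<Longrightarrow> i < d \<Longrightarrow>
          measure M {\<omega> \<in> space M. \<bar>Y d \<omega> i\<bar> \<ge> t} \<le> 2 * exp (- c1 * (ln t)\<^sup>2)"
    and c2: "c2 > 0"
    and lam: "lam \<ge> 2"
    and cond_ii: "\<And>d y. d \<ge> 1 \<Longrightarrow> y \<in> ({..<d} \<rightarrow>\<^sub>E (UNIV :: real set)) \<Longrightarrow>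
          \<bar>\<phi> d y\<bar> \<le> c2 * (1 + l2norm d y powr lam)"
  shows "\<exists>h. poly5 h \<and>
    (\<forall>d a R D \<epsilon> \<rho> (m::nat) fm fH.
       d \<ge> 1 \<and> architecture d a \<and> R > 0 \<and> D > 0 \<and>
       0 < \<epsilon> \<and> \<epsilon> < 1 \<and> 0 < \<rho> \<and> \<rho> < 1 \<and>
       real m \<ge> h (1 / \<epsilon>) (real (num_params a)) (ln R) (1 / \<rho>) D \<and>
       fH \<in> nn_class u v a R D \<and>
       (\<forall>f\<in>nn_class u v a R D. risk M (X d) (Y d) (\<phi> d) fH \<le> risk M (X d) (Y d) (\<phi> d) f) \<and>
       fm \<in> measurable M (sup_borel u v d (nn_class u v a R D)) \<and>
       (\<forall>\<omega>\<in>space M. \<forall>f\<in>nn_class u v a R D.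
          emp_risk m (xs d) (ys d) (\<phi> d) (fm \<omega>) \<omega> \<le> emp_risk m (xs d) (ys d) (\<phi> d) f \<omega>)
       \<longrightarrow> measure M {\<omega> \<in> space M.
              risk M (X d) (Y d) (\<phi> d) (fm \<omega>) - risk M (X d) (Y d) (\<phi> d) fH \<le> \<epsilon>}
            \<ge> 1 - \<rho>)"
proof -
  interpret prob_space M by (rule P)
  \<comment> \<open>A natural moment order that covers the growth \<open>2 * lam\<close> of the
    square of \<open>\<phi>\<close>.\<close>
  define p where "p = nat \<lceil>2 * lam\<rceil>"
  have p: "2 * lam \<le> real p" unfolding p_def by linarith
  obtain A where A: "A \<ge> 0" and mom: "\<And>Z. random_variable borel Z \<Longrightarrow>
      (\<And>t. t \<ge> 1 \<Longrightarrow> prob {\<omega> \<in> space M. \<bar>Z \<omega>\<bar> \<ge> t} \<le> 2 * exp (- c1 * (ln t)\<^sup>2)) \<Longrightarrow>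
      integrable M (\<lambda>\<omega>. \<bar>Z \<omega>\<bar> ^ p) \<and> expectation (\<lambda>\<omega>. \<bar>Z \<omega>\<bar> ^ p) \<le> A"
    by (rule lognormal_tail_moment[OF c1, of p]) blast
  define c where "c = 2 * c2\<^sup>2 * (2 + A)"
  have c: "c > 0" using c2 A by (simp add: c_def)
  define s where "s = 1 + \<bar>u\<bar> + \<bar>v\<bar>"
  \<comment> \<open>The arguments stand for \<open>1 / \<epsilon>\<close>, \<open>P(a)\<close>,
    \<open>1 / \<rho>\<close> and \<open>D\<close>. With \<open>V = c * x2 ^ (p + 1)\<close>, this
    truncation level solves \<open>2 * D * V / K = \<epsilon> * \<rho> / 32\<close>.\<close>
  define K where "K x1 x2 x4 x5 = 64 * x5 * (c * x2 ^ (p + 1)) * x1 * x4" for x1 x2 x4 x5 :: real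
  \<comment> \<open>The reciprocal of the net radius, solving
    \<open>(2 * D + 2 * K) / W = \<epsilon> / 8\<close>.\<close>
  define W where "W x1 x2 x4 x5 = 16 * (x5 + K x1 x2 x4 x5) * x1" for x1 x2 x4 x5 :: real
  \<comment> \<open>The sample size from \<open>union_bound_le\<close> with the exponent from
    \<open>covering_number_le_exp\<close>. The polynomial \<open>1 + x3^2\<close> replaces the
    positive part of \<open>ln R\<close>, and the final \<open>+ 1\<close> forces
    \<open>m > 0\<close>.\<close>
  define h where "h x1 x2 x3 x4 x5 = 128 * (x5\<^sup>2 + 2 * x5 * K x1 x2 x4 x5)\<^sup>2 * x1\<^sup>2 *
     (x2 * (2 + (1 + x3\<^sup>2) + x2 + x2 * (x2 + (1 + x3\<^sup>2)) + s + W x1 x2 x4 x5) + 4 * x4) + 1"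
    for x1 x2 x3 x4 x5 :: real
  have "poly5 h"
    unfolding h_def W_def K_def by (intro poly5_intros)
  moreover have "measure M {\<omega> \<in> space M.
              risk M (X d) (Y d) (\<phi> d) (fm \<omega>) - risk M (X d) (Y d) (\<phi> d) fH \<le> \<epsilon>} \<ge> 1 - \<rho>"
    if d: "d \<ge> 1" and a: "architecture d a" and R: "R > 0" and D: "D > 0" and \<epsilon>: "0 < \<epsilon>" and \<rho>: "0 < \<rho>" "\<rho> < 1"
      and m: "real m \<ge> h (1 / \<epsilon>) (real (num_params a)) (ln R) (1 / \<rho>) D"
      and fH: "fH \<in> nn_class u v a R D"
      and fm: "fm \<in> measurable M (sup_borel u v d (nn_class u v a R D))"
      and fm_min: "\<forall>\<omega>\<in>space M. \<forall>f\<in>nn_class u v a R D.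
          emp_risk m (xs d) (ys d) (\<phi> d) (fm \<omega>) \<omega> \<le> emp_risk m (xs d) (ys d) (\<phi> d) f \<omega>"
    for d a R D \<epsilon> \<rho> m fm fH
  proof -
    let ?H = "nn_class u v a R D" and ?n = "num_params a"
    note [measurable] = X_meas[OF d] Y_meas[OF d] phi_meas[OF d]
    have Yi: "random_variable borel (\<lambda>\<omega>. Y d \<omega> i)" if "i < d" for i
    proof -
      have "(\<lambda>y. y i) \<in> measurable (Rd d) lborel" unfolding Rd_def using that by (intro measurable_component_singleton) simp
      from measurable_compose[OF Y_meas[OF d] this] show ?thesis by simp
    qed
    have mom_i: "integrable M (\<lambda>\<omega>. \<bar>Y d \<omega> i\<bar> ^ p)" "expectation (\<lambda>\<omega>. \<bar>Y d \<omega> i\<bar> ^ p) \<le> A" if "i < d" for i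
      using mom[OF Yi[OF that] cond_i[OF d _ that]] by auto
    have lam0: "0 \<le> lam" using lam by simp
    note second_moment = polynomial_growth_second_moment[OF d Y_meas[OF d] phi_meas[OF d] cond_ii[OF d] lam0 p mom_i A]
    have nd: "d \<le> ?n" by (rule num_params_ge[OF a])
    have n: "?n \<ge> 1" using nd d by simp
    have sq: "integrable M (\<lambda>\<omega>. (\<phi> d (Y d \<omega>))\<^sup>2)" by (rule second_moment)
    have "expectation (\<lambda>\<omega>. (\<phi> d (Y d \<omega>))\<^sup>2) \<le> c * real d ^ (p + 1)"
      unfolding c_def by (rule second_moment)
    also have "\<dots> \<le> c * real ?n ^ (p + 1)" using c nd by (intro mult_left_mono power_mono) auto
    finally have V: "expectation (\<lambda>\<omega>. (\<phi> d (Y d \<omega>))\<^sup>2) \<le> c * real ?n ^ (p + 1)" .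
    have C: "AE \<omega> in M. X d \<omega> \<in> cube u v d" by (rule AE_uniform_cube[OF X_meas[OF d] X_unif[OF d]])
    have H_meas: "f \<in> borel_measurable (Rd d)" if "f \<in> ?H" for f by (rule nn_class_measurable[OF a that])
    have H_bound: "\<bar>f x\<bar> \<le> D" if "f \<in> ?H" "x \<in> cube u v d" for f x
      by (rule nn_class_bound[OF a that(1) _ that(2)]) (use D in simp)
    define K' where "K' = K (1 / \<epsilon>) (real ?n) (1 / \<rho>) D"
    define W' where "W' = W (1 / \<epsilon>) (real ?n) (1 / \<rho>) D"
    define r where "r = 1 + (ln R)\<^sup>2"
    define Q where "Q = (real ?n + 1) * exp r"
    \<comment> \<open>This grid width makes the net radius exactly \<open>1 / W'\<close>.\<close>
    define \<delta> where "\<delta> = 1 / (W' * (real ?n * Q ^ ?n * s))"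
    have K': "K' > 0" using D c \<epsilon> \<rho> n by (simp add: K'_def K_def)
    have W': "W' > 0" "W' = 16 * (D + K') / \<epsilon>" using D K' \<epsilon> by (simp_all add: W'_def W_def K'_def)
    have s: "s \<ge> 1" "\<bar>u\<bar> \<le> s" "\<bar>v\<bar> \<le> s" by (auto simp: s_def)
    have r: "r \<ge> 0" "exp r \<ge> 1" by (simp_all add: r_def)
    have "2 * ln R \<le> r" using zero_le_power2[of "ln R - 1"]
      unfolding r_def power2_diff by simp
    then have "ln R \<le> r" using r(1) by linarith
    then have Rr: "R \<le> exp r" using R by (metis exp_le_cancel_iff exp_ln)
    have Q: "Q > 0" unfolding Q_def by (intro mult_pos_pos) auto
    then have \<delta>: "\<delta> > 0" using W'(1) n s by (auto simp: \<delta>_def)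
    have \<eta>: "real ?n * Q ^ ?n * s * \<delta> = 1 / W'"
      unfolding \<delta>_def using Q n s(1) W'(1) by simp
    obtain F where F: "finite F" "F \<subseteq> ?H" and card_F: "real (card F) \<le> (2 * R / \<delta> + 1) ^ ?n"
      and net: "\<And>f. f \<in> ?H \<Longrightarrow> \<exists>g\<in>F. \<forall>x\<in>cube u v d. \<bar>f x - g x\<bar> \<le> 1 / W'"
      by (rule nn_class_net[OF a R D \<delta> r(2) Rr s Q_def, unfolded \<eta>]) blast
    define \<Theta> where "\<Theta> = real ?n * (2 + r + real ?n + real ?n * (real ?n + r) + s + W')"
    have card_F': "real (card F) \<le> exp \<Theta>"
      unfolding \<Theta>_def using card_F covering_number_le_exp[OF R Rr W'(1) n r(1) s(1) Q_def \<delta>_def] by linarith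
    have \<Theta>0: "\<Theta> \<ge> 0" unfolding \<Theta>_def using r s W' by (intro mult_nonneg_nonneg add_nonneg_nonneg) auto
    have m': "real m \<ge> 128 * (D\<^sup>2 + 2 * D * K')\<^sup>2 * (1 / \<epsilon>)\<^sup>2 * (\<Theta> + 4 * (1 / \<rho>)) + 1"
      using m unfolding h_def \<Theta>_def r_def K'_def W'_def .
    have "0 \<le> 128 * (D\<^sup>2 + 2 * D * K')\<^sup>2 * (1 / \<epsilon>)\<^sup>2 * (\<Theta> + 4 * (1 / \<rho>))"
      using \<Theta>0 \<rho> by (intro mult_nonneg_nonneg add_nonneg_nonneg) auto
    then have "real m > 0" using m' by linarith
    then have m0: "m > 0" by simp
    have "\<exists>E\<in>events. prob E \<ge> 1 - \<rho> \<and> (\<forall>\<omega>\<in>E. \<forall>f\<in>?H. \<forall>f0\<in>?H.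
           emp_risk m (xs d) (ys d) (\<phi> d) f \<omega> \<le> emp_risk m (xs d) (ys d) (\<phi> d) f0 \<omega> \<longrightarrow>
           risk M (X d) (Y d) (\<phi> d) f - risk M (X d) (Y d) (\<phi> d) f0 \<le> \<epsilon>)"
    proof (rule erm_excess_risk[where C = "cube u v d" and F = F and \<eta> = "1 / W'" and K = K'
          and V = "c * real ?n ^ (p + 1)" and D = D and S = "Rd d" and T = "Rd d"])
      show "2 * D * (c * real ?n ^ (p + 1)) / K' \<le> \<epsilon> * \<rho> / 32"
        using D c \<epsilon> \<rho> n by (simp add: K'_def K_def field_simps)
      show "1 / W' * (2 * D + 2 * K') \<le> \<epsilon> / 8"
        unfolding W'(2) using D K' \<epsilon> by (simp add: field_simps)
      show "real (card F) * (2 * exp (- (real m * \<epsilon>\<^sup>2 / (128 * (D\<^sup>2 + 2 * D * K')\<^sup>2)))) \<le> \<rho> / 2"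
        using m' D K' by (intro union_bound_le[OF card_F' _ \<epsilon> \<rho>(1)]) (auto intro: add_pos_pos)
    qed (fact X_meas[OF d] Y_meas[OF d] iid_indep[OF d] iid_distr[OF d] phi_meas[OF d] sets_cube C H_meas H_bound D F net sq V K' m0 \<epsilon> \<rho>)+
    then obtain E where E: "E \<in> events" "prob E \<ge> 1 - \<rho>" and E_imp: "\<And>\<omega> f f0. \<omega> \<in> E \<Longrightarrow> f \<in> ?H \<Longrightarrow> f0 \<in> ?H \<Longrightarrow>
           emp_risk m (xs d) (ys d) (\<phi> d) f \<omega> \<le> emp_risk m (xs d) (ys d) (\<phi> d) f0 \<omega> \<Longrightarrow>
           risk M (X d) (Y d) (\<phi> d) f - risk M (X d) (Y d) (\<phi> d) f0 \<le> \<epsilon>"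
      by blast
    let ?L = "2 * D + 2 * expectation (\<lambda>\<omega>. \<bar>\<phi> d (Y d \<omega>)\<bar>)"
    have L: "?L > 0" using D by (intro add_pos_nonneg mult_nonneg_nonneg) auto
    have lip: "\<bar>risk M (X d) (Y d) (\<phi> d) f - risk M (X d) (Y d) (\<phi> d) g\<bar> \<le> sup_dist u v d f g * ?L"
      if "f \<in> ?H" "g \<in> ?H" for f g
      using that
      by (intro risk_lipschitz[OF X_meas[OF d] Y_meas[OF d] phi_meas[OF d] C _ _ _ _ _ sq] H_meas H_bound sup_dist_upper[where D = D])
    \<comment> \<open>The good event \<open>E\<close> only has to be contained in this set;
      monotonicity of the measure then requires \<open>?G\<close> to be an event, which the
      Lipschitz bound supplies.\<close>
    let ?G = "{\<omega> \<in> space M. risk M (X d) (Y d) (\<phi> d) (fm \<omega>) - risk M (X d) (Y d) (\<phi> d) fH \<le> \<epsilon>}"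
    have G: "?G \<in> events"
      using sup_borel_sublevel_measurable[OF fm lip L, of "\<epsilon> + risk M (X d) (Y d) (\<phi> d) fH"]
      by (simp add: diff_le_eq)
    have fm_H: "fm \<omega> \<in> ?H" if "\<omega> \<in> space M" for \<omega>
      using measurable_space[OF fm that] by (simp add: space_sup_borel)
    have "E \<subseteq> ?G"
    proof
      fix \<omega> assume \<omega>: "\<omega> \<in> E"
      then have sp: "\<omega> \<in> space M" using E sets.sets_into_space by blast
      with \<omega> fm_min fH show "\<omega> \<in> ?G" by (auto intro!: E_imp[OF \<omega> fm_H])
    qed
    then show ?thesis using E finite_measure_mono[OF _ G] by (meson order.trans)
  qed
  ultimately show ?thesis by (intro exI[of _ h] conjI) blast+
qed

end
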